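(* The class ${}^{\perp_0}\mathbb{Z}=\{A \text{ an abelian group} : \operatorname{Hom}(A,\mathbb{Z})=0\}$ is deconstructible if and only if there exists an $\omega_1$-strongly compact cardinal.
   Context: An uncountable cardinal $\kappa$ is $\omega_1$-strongly compact if every $\kappa$-complete filter (on any set) extends to an $\omega_1$-complete ultrafilter. For a class $\mathcal{K}$ of modules (here abelian groups, i.e. $\mathbb{Z}$-modules), a $\mathcal{K}$-filtration is a $\subseteq$-increasing, $\subseteq$-continuous sequence $\langle M_\xi : \xi<\eta\rangle$ of modules with $M_0=0$ such that for every $\xi$ with $\xi+1<\eta$, $M_\xi$ is a submodule of $M_{\xi+1}$ and $M_{\xi+1}/M_\xi$ is isomorphic to a member of $\mathcal{K}$; a module is $\mathcal{K}$-filtered if it is the union of some $\mathcal{K}$-filtration, and $\mathrm{Filt}(\mathcal{K})$ is the class of $\mathcal{K}$-filtered modules. For a regular cardinal $\kappa$, $\mathcal{K}^{<\kappa}$ denotes the class of ${<}\kappa$-presented members of $\mathcal{K}$. $\mathcal{K}$ is $\kappa$-deconstructible if $\mathcal{K}=\mathrm{Filt}(\mathcal{K}^{<\kappa})$, and deconstructible if it is $\kappa$-deconstructible for some regular cardinal $\kappa$. *)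

theory Defs
  imports "HOL-Algebra.Free_Abelian_Groups"
begin

unbundle cardinal_syntax

text \<open>
  The theorem quantifies over all sets, all cardinals and all abelian groups, which no single HOL
  type provides. The ambient set theory is therefore made explicit: a type of class \<open>zfc\<close>
  carries a membership relation (\<open>elts x\<close> is the set of members of \<open>x\<close>) satisfying the
  axioms of ZFC, with the two schemas quantified over arbitrary predicates and functions of HOL.
  Choice needs no axiom of its own (lemma \<open>zfc_choice\<close> below).
\<close>

class zfc =
  fixes elts :: "'a \<Rightarrow> 'a set"
  assumes zfc_extensionality: "elts x = elts y \<Longrightarrow> x = y"
    and zfc_foundation: "elts x \<noteq> {} \<Longrightarrow> \<exists>y\<in>elts x. elts y \<inter> elts x = {}"
    and zfc_pairing: "\<exists>z. elts z = {x, y}"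
    and zfc_union: "\<exists>z. elts z = (\<Union>y\<in>elts x. elts y)"
    and zfc_powerset: "\<exists>z. elts z = {y. elts y \<subseteq> elts x}"
    and zfc_infinity:
      "\<exists>z. (\<exists>e\<in>elts z. elts e = {}) \<and> (\<forall>y\<in>elts z. \<exists>s\<in>elts z. elts s = insert y (elts y))"
    and zfc_separation: "\<exists>z. elts z = {y \<in> elts x. P y}"
    and zfc_replacement: "\<exists>z. elts z = F ` elts x"

lemma zfc_choice:
  fixes x :: "'v::zfc"
  assumes ne: "\<And>y. y \<in> elts x \<Longrightarrow> elts y \<noteq> {}"
    and disj: "\<And>y y'. y \<in> elts x \<Longrightarrow> y' \<in> elts x \<Longrightarrow> y \<noteq> y' \<Longrightarrow> elts y \<inter> elts y' = {}"
  shows "\<exists>z. \<forall>y\<in>elts x. \<exists>!w. w \<in> elts y \<inter> elts z"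
proof -
  define c where "c y = (SOME w. w \<in> elts y)" for y :: 'v
  have c: "c y \<in> elts y" if "y \<in> elts x" for y
    unfolding c_def using ne[OF that] by (simp add: some_in_eq)
  obtain z where z: "elts z = c ` elts x"
    using zfc_replacement[of c x] by blast
  have "\<exists>!w. w \<in> elts y \<inter> elts z" if y: "y \<in> elts x" for y
  proof (rule ex1I[of _ "c y"])
    show "c y \<in> elts y \<inter> elts z" using c[OF y] y z by blast
    fix w assume "w \<in> elts y \<inter> elts z"
    then obtain y' where y': "y' \<in> elts x" "w = c y'" "w \<in> elts y" using z by blast
    then have "y' = y" using disj[OF y'(1) y] c[OF y'(1)] by blast
    then show "w = c y" using y' by simp
  qed
  then show ?thesis by blast
qed

text \<open>
  A subset of the universe is \<open>small\<close> if it is a set of the universe; the others are proper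
  classes.
\<close>

definition small :: "'v::zfc set \<Rightarrow> bool"
  where "small A \<longleftrightarrow> (\<exists>x. A = elts x)"


subsection \<open>Strongly compact cardinals\<close>

text \<open>
  A cardinal of the universe is a \<open>Card_order\<close> with small field. Smallness is essential: the
  cardinality of the whole universe is not a cardinal of the universe.
\<close>

definition cardinal :: "'v::zfc rel \<Rightarrow> bool"
  where "cardinal \<kappa> \<longleftrightarrow> Card_order \<kappa> \<and> small (Field \<kappa>)"

definition filter_on :: "'a set \<Rightarrow> 'a set set \<Rightarrow> bool"
  where "filter_on Y \<F> \<longleftrightarrow>
    \<F> \<subseteq> Pow Y \<and> Y \<in> \<F> \<and> {} \<notin> \<F> \<and>
    (\<forall>A\<in>\<F>. \<forall>B\<in>\<F>. A \<inter> B \<in> \<F>) \<and>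
    (\<forall>A\<in>\<F>. \<forall>B. A \<subseteq> B \<and> B \<subseteq> Y \<longrightarrow> B \<in> \<F>)"

definition ultrafilter_on :: "'a set \<Rightarrow> 'a set set \<Rightarrow> bool"
  where "ultrafilter_on Y \<U> \<longleftrightarrow>
    filter_on Y \<U> \<and> (\<forall>A. A \<subseteq> Y \<longrightarrow> A \<in> \<U> \<or> Y - A \<in> \<U>)"

definition complete_family :: "'k rel \<Rightarrow> 'a set set \<Rightarrow> bool"
  where "complete_family \<kappa> \<F> \<longleftrightarrow>
    (\<forall>\<S>. \<S> \<subseteq> \<F> \<and> \<S> \<noteq> {} \<and> |\<S>| <o \<kappa> \<longrightarrow> \<Inter>\<S> \<in> \<F>)"

abbreviation omega1 :: "nat set rel"
  where "omega1 \<equiv> cardSuc natLeq"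

definition omega1_strongly_compact :: "'v::zfc rel \<Rightarrow> bool"
  where "omega1_strongly_compact \<kappa> \<longleftrightarrow>
    cardinal \<kappa> \<and> natLeq <o \<kappa> \<and>
    (\<forall>(Y :: 'v set) \<F>. small Y \<and> filter_on Y \<F> \<and> complete_family \<kappa> \<F> \<longrightarrow>
       (\<exists>\<U>. ultrafilter_on Y \<U> \<and> complete_family omega1 \<U> \<and> \<F> \<subseteq> \<U>))"


subsection \<open>Filtrations and deconstructibility\<close>

definition ab_groups :: "'v::zfc monoid set"
  where "ab_groups = {A. comm_group A \<and> small (carrier A)}"

text \<open>
  The ordinal length of a filtration is a well-order with small field; its elements are the
  indices.
\<close>

definition is_succ :: "'a rel \<Rightarrow> 'a \<Rightarrow> 'a \<Rightarrow> bool"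
  where "is_succ r i j \<longleftrightarrow> i \<in> Field r \<and> j \<in> Field r \<and> underS r j = under r i"

definition is_limit :: "'a rel \<Rightarrow> 'a \<Rightarrow> bool"
  where "is_limit r j \<longleftrightarrow> j \<in> Field r \<and> underS r j \<noteq> {} \<and> \<not> (\<exists>i. is_succ r i j)"

text \<open>
  By continuity all members of a filtration are submodules of its union \<open>M\<close>, so a filtration is
  given by the carriers \<open>N i\<close> of its members, with the operations inherited from \<open>M\<close>.
\<close>

definition filtration ::
  "'v::zfc monoid set \<Rightarrow> 'v monoid \<Rightarrow> 'v rel \<Rightarrow> ('v \<Rightarrow> 'v set) \<Rightarrow> bool"
  where "filtration \<K> M r N \<longleftrightarrow>
    Well_order r \<and> small (Field r) \<and>
    (\<forall>i\<in>Field r. subgroup (N i) M) \<and>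
    (\<forall>i j. (i, j) \<in> r \<longrightarrow> N i \<subseteq> N j) \<and>
    (\<forall>i\<in>Field r. underS r i = {} \<longrightarrow> N i = {\<one>\<^bsub>M\<^esub>}) \<and>
    (\<forall>j. is_limit r j \<longrightarrow> N j = (\<Union>i\<in>underS r j. N i)) \<and>
    (\<forall>i j. is_succ r i j \<longrightarrow> (\<exists>K\<in>\<K>. (M\<lparr>carrier := N j\<rparr> Mod N i) \<cong> K))"

definition Filt :: "'v::zfc monoid set \<Rightarrow> 'v monoid set"
  where "Filt \<K> = {M \<in> ab_groups. \<exists>r N. filtration \<K> M r N \<and> carrier M = (\<Union>i\<in>Field r. N i)}"

text \<open>Fewer than \<open>\<kappa>\<close> generators \<open>Y\<close> and fewer than \<open>\<kappa>\<close> relations \<open>R\<close>.\<close>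

definition less_presented :: "'v::zfc rel \<Rightarrow> 'v monoid \<Rightarrow> bool"
  where "less_presented \<kappa> M \<longleftrightarrow>
    (\<exists>(Y :: 'v set) R. |Y| <o \<kappa> \<and> R \<subseteq> carrier (free_Abelian_group Y) \<and> |R| <o \<kappa> \<and>
       M \<cong> (free_Abelian_group Y Mod generate (free_Abelian_group Y) R))"

definition kappa_deconstructible :: "'v::zfc rel \<Rightarrow> 'v monoid set \<Rightarrow> bool"
  where "kappa_deconstructible \<kappa> \<K> \<longleftrightarrow> \<K> = Filt {M \<in> \<K>. less_presented \<kappa> M}"

definition deconstructible :: "'v::zfc monoid set \<Rightarrow> bool"
  where "deconstructible \<K> \<longleftrightarrow>
    (\<exists>\<kappa>. cardinal \<kappa> \<and> cinfinite \<kappa> \<and> regularCard \<kappa> \<and> kappa_deconstructible \<kappa> \<K>)"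

definition left_perp0 :: "'c monoid \<Rightarrow> 'v::zfc monoid set"
  where "left_perp0 C = {A \<in> ab_groups. \<forall>f\<in>hom A C. \<forall>a\<in>carrier A. f a = \<one>\<^bsub>C\<^esub>}"

end

theory Submission
  imports Defs "HOL-Library.Countable_Set_Type"
begin

text \<open>
  If \<open>\<kappa>\<close> is \<open>\<omega>\<^sub>1\<close>-strongly compact and \<open>Hom(A, \<int>) = 0\<close>, then every \<open>a \<in> A\<close> lies in a subgroup
  of size at most \<open>\<kappa>\<close> all of whose homomorphisms to \<open>\<int>\<close> vanish at \<open>a\<close>: otherwise a limit of
  homomorphisms on small subgroups along a fine \<open>\<omega>\<^sub>1\<close>-complete ultrafilter would be a homomorphism on
  \<open>A\<close> that does not vanish at \<open>a\<close>. Closing off \<open>\<omega>\<close> times puts \<open>a\<close> into a subgroup \<open>B\<close> of size at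
  most \<open>\<kappa>\<close> with \<open>Hom(B, \<int>) = 0\<close>. Adding these subgroups one after the other gives a filtration of
  \<open>A\<close> with \<open>\<kappa>\<^sup>+\<close>-small quotients.

  Conversely, if the class is \<open>\<kappa>\<close>-deconstructible, every nonzero member contains a nonzero member of
  size at most \<open>\<kappa>\<close>. For a \<open>\<kappa>\<^sup>+\<close>-complete filter \<open>\<F>\<close> on \<open>Y\<close>, no nonzero subgroup of size at most
  \<open>\<kappa>\<close> of the reduced power \<open>\<int>\<^sup>Y / \<F>\<close> is in the class, because it lifts to \<open>\<int>\<^sup>X\<close> for some
  \<open>X \<in> \<F>\<close>. So there is a nonzero homomorphism \<open>h\<close> from \<open>\<int>\<^sup>Y\<close> to \<open>\<int>\<close> killing the functions that
  are null modulo \<open>\<F>\<close>. Since \<open>\<int>\<close> is slender, some set \<open>X\<close> with \<open>h\<close> nonzero on \<open>\<int>\<^sup>X\<close> cannot be split into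
  two such sets, and the sets \<open>Z\<close> with \<open>h\<close> zero on \<open>\<int>\<^bsup>X - Z\<^esup>\<close> form an \<open>\<omega>\<^sub>1\<close>-complete ultrafilter
  extending \<open>\<F>\<close>.
\<close>

subsection \<open>Sets of the universe\<close>

lemma small_subset:
  fixes A :: "'v::zfc set"
  assumes "small A" "B \<subseteq> A"
  shows "small B"
proof -
  obtain x where x: "A = elts x"
    using assms(1) unfolding small_def by blast
  obtain z where "elts z = {y \<in> elts x. y \<in> B}"
    using zfc_separation[of x "\<lambda>y. y \<in> B"] by blast
  then have "B = elts z"
    using assms(2) x by blast
  then show ?thesis
    unfolding small_def by blast
qed

lemma small_Un:
  fixes A :: "'v::zfc set"
  assumes "small A" "small B"
  shows "small (A \<union> B)"
proof -
  obtain x y where xy: "A = elts x" "B = elts y"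
    using assms unfolding small_def by blast
  obtain p where p: "elts p = {x, y}"
    using zfc_pairing by blast
  obtain z where "elts z = (\<Union>w\<in>elts p. elts w)"
    using zfc_union by blast
  then have "A \<union> B = elts z"
    using xy p by simp
  then show ?thesis
    unfolding small_def by blast
qed

lemma not_mem_self: "(x::'v::zfc) \<notin> elts x"
proof
  assume x: "x \<in> elts x"
  obtain p where p: "elts p = {x, x}"
    using zfc_pairing[of x x] by blast
  then have "\<exists>y\<in>elts p. elts y \<inter> elts p = {}"
    by (intro zfc_foundation) simp
  then show False
    using x p by auto
qed

lemma infinite_small_exists: "\<exists>W::'v::zfc set. small W \<and> infinite W"
proof -
  obtain z :: 'v where z: "\<exists>e\<in>elts z. elts e = {}"
      "\<forall>y\<in>elts z. \<exists>s\<in>elts z. elts s = insert y (elts y)"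
    using zfc_infinity by blast
  obtain e where e: "e \<in> elts z" "elts e = {}"
    using z(1) by blast
  obtain s where s: "\<And>y. y \<in> elts z \<Longrightarrow> s y \<in> elts z \<and> elts (s y) = insert y (elts y)"
    using z(2) by metis
  \<comment> \<open>These are successive von Neumann successors of the empty set \<open>e\<close>.
    Each belongs to all later ones, so \<open>not_mem_self\<close> makes them distinct.\<close>
  define g where "g n = (s ^^ n) e" for n
  have g_in: "g n \<in> elts z" for n
    unfolding g_def using e s by (induction n) auto
  have g_Suc: "elts (g (Suc n)) = insert (g n) (elts (g n))" for n
    using s[OF g_in[of n]] unfolding g_def by simp
  have g_less: "g m \<in> elts (g n)" if "m < n" for m n
    using that by (induction n) (auto simp: g_Suc less_Suc_eq)
  have "inj g"
    by (rule linorder_injI) (metis g_less not_mem_self)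
  then have "infinite (elts z)"
    using g_in by (meson finite_subset image_subset_iff infinite_UNIV_char_0 finite_imageD)
  then show ?thesis
    unfolding small_def by blast
qed

lemma infinite_UNIV_zfc: "infinite (UNIV :: 'v::zfc set)"
  using infinite_small_exists[where 'v='v] infinite_super[OF subset_UNIV] by auto

lemma small_elts_ex:
  assumes "small (A :: 'v::zfc set)" "B \<subseteq> A"
  shows "\<exists>b. elts b = B"
  using small_subset[OF assms] unfolding small_def by (blast intro: sym)

lemma small_Collect_elts:
  assumes "small (A :: 'v::zfc set)"
  shows "small {b. elts b \<subseteq> A}"
proof -
  obtain x where "A = elts x"
    using assms unfolding small_def by blast
  then show ?thesis
    using zfc_powerset[of x] unfolding small_def by auto
qed

text \<open>The members of \<open>Pow A\<close> are sets of elements, not elements, so smallness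
  does not apply to \<open>Pow A\<close> itself. The codes \<open>b\<close> of subsets of
  \<open>A\<close> form a small set that maps onto it.\<close>

lemma small_Pow_bound:
  assumes "small (A :: 'v::zfc set)"
  shows "\<exists>P::'v set. small P \<and> |Pow A| \<le>o |P|"
proof (intro exI conjI)
  show "small {b. elts b \<subseteq> A}"
    by (rule small_Collect_elts[OF assms])
  have "Pow A \<subseteq> elts ` {b. elts b \<subseteq> A}"
  proof
    fix B assume "B \<in> Pow A"
    then obtain b where "elts b = B"
      using small_elts_ex[OF assms] by blast
    then show "B \<in> elts ` {b. elts b \<subseteq> A}"
      using \<open>B \<in> Pow A\<close> by auto
  qed
  then show "|Pow A| \<le>o |{b. elts b \<subseteq> A}|"
    by (rule ordLeq_transitive[OF card_of_mono1 card_of_image])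
qed

text \<open>\<open>B\<close> may have any type: this is how objects of higher type, such as groups
  of cosets, are brought into the universe.\<close>

lemma small_copy:
  assumes "small (A :: 'v::zfc set)" "|B| \<le>o |A|"
  shows "\<exists>f. inj_on f B \<and> f ` B \<subseteq> A \<and> small (f ` B)"
proof -
  obtain f where "inj_on f B" "f ` B \<subseteq> A"
    using assms(2) card_of_ordLeq[of B A] by auto
  then show ?thesis
    using small_subset[OF assms(1)] by blast
qed

subsection \<open>Successor cardinals\<close>

text \<open>\<open>cardSuc \<kappa>\<close> is a relation between sets of elements, so it is not
  literally a cardinal of the universe. It is copied into a small set at least as large as
  \<open>Pow (Field \<kappa>)\<close>.\<close>

lemma cardinal_successor:
  fixes \<kappa> :: "'v::zfc rel"
  assumes "cardinal \<kappa>"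
  shows "\<exists>\<mu>::'v rel. cardinal \<mu> \<and> \<mu> =o cardSuc \<kappa>"
proof -
  have co: "Card_order \<kappa>" and sm: "small (Field \<kappa>)"
    using assms unfolding cardinal_def by auto
  obtain P :: "'v set" where P: "small P" "|Pow (Field \<kappa>)| \<le>o |P|"
    using small_Pow_bound[OF sm] by blast
  have "\<kappa> <o |Pow (Field \<kappa>)|"
    using co Card_order_Pow by blast
  then have "cardSuc \<kappa> \<le>o |Pow (Field \<kappa>)|"
    using cardSuc_least co card_of_Card_order by blast
  then have "|Field (cardSuc \<kappa>)| \<le>o |P|"
    using P(2) by (meson card_of_Field_ordIso cardSuc_Card_order co ordIso_ordLeq_trans ordLeq_transitive)
  then obtain f :: "'v set \<Rightarrow> 'v" where f: "inj_on f (Field (cardSuc \<kappa>))" "small (f ` Field (cardSuc \<kappa>))"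
    using small_copy[OF P(1)] by blast
  have "|f ` Field (cardSuc \<kappa>)| =o |Field (cardSuc \<kappa>)|"
    using f(1) by (meson card_of_ordIso inj_on_imp_bij_betw ordIso_symmetric)
  also have "|Field (cardSuc \<kappa>)| =o cardSuc \<kappa>"
    by (rule card_of_Field_ordIso[OF cardSuc_Card_order[OF co]])
  finally (ordIso_transitive) show ?thesis
    using f(2) unfolding cardinal_def by (intro exI[of _ "|f ` Field (cardSuc \<kappa>)|"]) auto
qed

lemma infinite_Field_of_natLeq:
  assumes "natLeq \<le>o r"
  shows "infinite (Field r)"
  using assms by (metis Field_natLeq card_of_mono2 card_of_ordLeq_infinite infinite_UNIV_nat)

lemma ordLess_cardSuc_iff:
  assumes "Card_order \<kappa>" "\<mu> =o cardSuc \<kappa>"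
  shows "|A| <o \<mu> \<longleftrightarrow> |A| \<le>o \<kappa>"
proof -
  have "|A| <o \<mu> \<longleftrightarrow> |A| <o cardSuc \<kappa>"
    by (rule iffI) (erule ordLess_ordIso_trans, rule assms(2),
        erule ordLess_ordIso_trans, rule ordIso_symmetric[OF assms(2)])
  then show ?thesis
    using cardSuc_ordLeq_ordLess[OF assms(1) card_of_Card_order[of A]] by simp
qed

subsection \<open>Subgroups generated by few elements\<close>

text \<open>The free abelian group on an infinite set has the size of that set. Adding a countably
  infinite \<open>W\<close> reduces a finite \<open>Y\<close> to this case.\<close>

lemma card_free_Abelian_group:
  fixes Y :: "'v::zfc set"
  assumes \<kappa>: "Card_order \<kappa>" "natLeq \<le>o \<kappa>" and Y: "|Y| \<le>o \<kappa>"
  shows "|carrier (free_Abelian_group Y)| \<le>o \<kappa>"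
proof -
  obtain W :: "'v set" where W: "countable W" "infinite W"
    using infinite_countable_subset'[OF infinite_UNIV_zfc[where 'v='v]] by blast
  have inf\<kappa>: "infinite (Field \<kappa>)"
    by (rule infinite_Field_of_natLeq[OF \<kappa>(2)])
  have "|W| \<le>o \<kappa>"
    using ordLeq_transitive[OF _ \<kappa>(2)] W(1) countable_card_le_natLeq by blast
  then have YW: "|Y \<union> W| \<le>o \<kappa>"
    using card_of_Un_ordLeq_infinite_Field[OF inf\<kappa> Y _ \<kappa>(1)] by blast
  have "carrier (free_Abelian_group Y) \<subseteq> carrier (free_Abelian_group (Y \<union> W))"
    by auto
  then have "|carrier (free_Abelian_group Y)| \<le>o |carrier (free_Abelian_group (Y \<union> W))|"
    by (rule card_of_mono1)
  also have "|carrier (free_Abelian_group (Y \<union> W))| =o |Y \<union> W|"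
    using eqpoll_free_Abelian_group_infinite[of "Y \<union> W"] W(2)
    by (simp add: eqpoll_iff_card_of_ordIso)
  finally (ordLeq_ordIso_trans) show ?thesis
    by (rule ordLeq_transitive[OF _ YW])
qed

text \<open>The image of the free abelian group on \<open>C\<close> is a subgroup, and it is no
  larger than that free group.\<close>

lemma subgroup_cover:
  fixes G :: "('v::zfc, 'c) monoid_scheme"
  assumes G: "comm_group G" and C: "C \<subseteq> carrier G" "|C| \<le>o \<kappa>"
    and \<kappa>: "Card_order \<kappa>" "natLeq \<le>o \<kappa>"
  shows "\<exists>H. subgroup H G \<and> C \<subseteq> H \<and> |H| \<le>o \<kappa>"
proof -
  interpret comm_group G by fact
  obtain h where h: "h \<in> hom (free_Abelian_group C) G" "\<And>x. x \<in> C \<Longrightarrow> h (frag_of x) = x"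
    using free_Abelian_group_universal[of id C] C(1) by auto
  interpret h: group_hom "free_Abelian_group C" G h
    using h(1) by (simp add: group_hom_def group_hom_axioms_def)
  let ?H = "h ` carrier (free_Abelian_group C)"
  have "subgroup ?H G"
    by (rule h.img_is_subgroup)
  moreover have "C \<subseteq> ?H"
    using h(2) by (metis frag_of_in_free_Abelian_group image_eqI subsetI)
  moreover have "|?H| \<le>o \<kappa>"
    by (rule ordLeq_transitive[OF card_of_image card_free_Abelian_group[OF \<kappa> C(2)]])
  ultimately show ?thesis by blast
qed

subsection \<open>Groups without nonzero homomorphisms to the integers\<close>

text \<open>In contrast to \<open>left_perp0 integer_group\<close>, this applies to groups over any
  type, in particular to quotients, whose elements are cosets.\<close>

definition perp_Z :: "('a, 'b) monoid_scheme \<Rightarrow> bool"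
  where "perp_Z A \<longleftrightarrow> (\<forall>f\<in>hom A integer_group. \<forall>a\<in>carrier A. f a = 0)"

lemma left_perp0_integer_group: "A \<in> left_perp0 integer_group \<longleftrightarrow> A \<in> ab_groups \<and> perp_Z A"
  unfolding left_perp0_def perp_Z_def by simp

lemma hom_integer_group_add:
  "f \<in> hom A integer_group \<Longrightarrow> x \<in> carrier A \<Longrightarrow> y \<in> carrier A \<Longrightarrow> f (x \<otimes>\<^bsub>A\<^esub> y) = f x + f y"
  using hom_mult by fastforce

lemma hom_integer_groupI:
  "(\<And>x y. x \<in> carrier A \<Longrightarrow> y \<in> carrier A \<Longrightarrow> f (x \<otimes>\<^bsub>A\<^esub> y) = f x + f y) \<Longrightarrow> f \<in> hom A integer_group"
  by (simp add: hom_def)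

lemma hom_integer_group_restrict:
  "f \<in> hom A integer_group \<Longrightarrow> H \<subseteq> carrier A \<Longrightarrow> f \<in> hom (A\<lparr>carrier := H\<rparr>) integer_group"
  by (rule hom_integer_groupI) (auto intro: hom_integer_group_add)

lemma perp_Z_surj:
  assumes "perp_Z A" "g \<in> hom A Q" "g ` carrier A = carrier Q"
  shows "perp_Z Q"
  unfolding perp_Z_def
proof (intro ballI)
  fix f q assume f: "f \<in> hom Q integer_group" and "q \<in> carrier Q"
  then obtain a where a: "a \<in> carrier A" "q = g a"
    using assms(3) by blast
  have "f \<circ> g \<in> hom A integer_group"
    by (rule hom_compose[OF assms(2) f])
  then show "f q = 0"
    using assms(1) a unfolding perp_Z_def by fastforce
qed

lemma perp_Z_iso:
  assumes "perp_Z A" "A \<cong> B"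
  shows "perp_Z B"
proof -
  obtain g where "g \<in> iso A B"
    using assms(2) unfolding is_iso_def by auto
  then show ?thesis
    using perp_Z_surj[OF assms(1)] by (auto simp: iso_def bij_betw_def)
qed

text \<open>A homomorphism that is zero on \<open>N\<close> factors through
  \<open>G Mod N\<close>.\<close>

lemma perp_Z_extension:
  assumes G: "group G" and N: "N \<lhd> G" "perp_Z (G Mod N)"
    and f: "f \<in> hom G integer_group" "\<And>x. x \<in> N \<Longrightarrow> f x = 0" and x: "x \<in> carrier G"
  shows "f x = 0"
proof -
  interpret group_hom G integer_group f
    using G f(1) by (simp add: group_hom_def group_hom_axioms_def)
  have "N \<subseteq> kernel G integer_group f"
    using f(2) normal_imp_subgroup[OF N(1)] subgroup.subset by (fastforce simp: kernel_def)
  then obtain g where "g \<in> hom (G Mod N) integer_group" "g (N #>\<^bsub>G\<^esub> x) = f x"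
    using FactGroup_universal_kernel[OF N(1)] x by metis
  moreover have "N #>\<^bsub>G\<^esub> x \<in> carrier (G Mod N)"
    using x by (simp add: carrier_FactGroup)
  ultimately show ?thesis
    using N(2) unfolding perp_Z_def by force
qed

lemma subgroup_comm_group:
  assumes "comm_group G" "subgroup H G"
  shows "comm_group (G\<lparr>carrier := H\<rparr>)"
proof -
  interpret comm_group G by fact
  interpret H: group "G\<lparr>carrier := H\<rparr>"
    by (rule subgroup_imp_group[OF assms(2)])
  show ?thesis
    using subgroup.subset[OF assms(2)]
    by (intro H.group_comm_groupI) (auto intro!: m_comm)
qed

lemma subgroup_normal_in:
  assumes "comm_group G" "subgroup H G" "subgroup K G" "H \<subseteq> K"
  shows "H \<lhd> G\<lparr>carrier := K\<rparr>"
proof -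
  interpret K: comm_group "G\<lparr>carrier := K\<rparr>"
    using assms(1,3) by (rule subgroup_comm_group)
  have "subgroup H (G\<lparr>carrier := K\<rparr>)"
    using group.subgroup_incl[OF comm_group.axioms(2)] assms by blast
  then show ?thesis
    by (simp add: K.normal_iff_subgroup)
qed

subsection \<open>Small presentations\<close>

lemma group_copy:
  fixes Q :: "'b monoid" and A :: "'v::zfc set"
  assumes Q: "comm_group Q" and A: "small A" "|carrier Q| \<le>o |A|"
  shows "\<exists>K::'v monoid. K \<in> ab_groups \<and> Q \<cong> K"
proof -
  interpret comm_group Q by fact
  obtain f :: "'b \<Rightarrow> 'v" where f: "inj_on f (carrier Q)" "small (f ` carrier Q)"
    using small_copy[OF A] by blast
  define g where "g = inv_into (carrier Q) f"
  have gf: "g (f x) = x" if "x \<in> carrier Q" for x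
    unfolding g_def using f(1) that by simp
  define K where "K = \<lparr>carrier = f ` carrier Q, monoid.mult = (\<lambda>x y. f (g x \<otimes>\<^bsub>Q\<^esub> g y)), one = f \<one>\<^bsub>Q\<^esub>\<rparr>"
  have iso: "f \<in> iso Q K"
    unfolding iso_def hom_def K_def using f(1) by (auto simp: bij_betw_def gf)
  \<comment> \<open>\<open>iso_imp_img_comm_group\<close> speaks of \<open>K\<close> with its unit
    replaced by the image of the unit of \<open>Q\<close>; here the two units coincide.\<close>
  have "K\<lparr>one := f \<one>\<^bsub>Q\<^esub>\<rparr> = K"
    unfolding K_def by simp
  then have "comm_group K"
    using iso_imp_img_comm_group[OF iso] by simp
  then show ?thesis
    using f(2) iso unfolding ab_groups_def is_iso_def by (auto simp: K_def)
qed

text \<open>All elements of \<open>K\<close> serve as generators, and the whole kernel of the map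
  from the free group serves as the set of relations.\<close>

lemma less_presentedI:
  fixes K :: "'v::zfc monoid"
  assumes K: "comm_group K" "|carrier K| \<le>o \<kappa>" and \<kappa>: "Card_order \<kappa>" "natLeq \<le>o \<kappa>"
    and \<mu>: "\<mu> =o cardSuc \<kappa>"
  shows "less_presented \<mu> K"
proof -
  interpret K: comm_group K by fact
  let ?F = "free_Abelian_group (carrier K)"
  obtain h where h: "h \<in> hom ?F K" "\<And>x. x \<in> carrier K \<Longrightarrow> h (frag_of x) = x"
    using K.free_Abelian_group_universal[of id "carrier K"] by auto
  interpret h: group_hom ?F K h
    using h(1) by (simp add: group_hom_def group_hom_axioms_def)
  let ?R = "kernel ?F K h"
  have onto: "h ` carrier ?F = carrier K"
  proof
    show "carrier K \<subseteq> h ` carrier ?F"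
      using h(2) by (metis frag_of_in_free_Abelian_group image_eqI subsetI)
  qed (use h(1) in \<open>auto simp: hom_def\<close>)
  have R: "generate ?F ?R = ?R"
    using h.generate_subgroup_incl[OF subset_refl h.subgroup_kernel] generate.incl[of _ ?R ?F] by blast
  have "?F Mod ?R \<cong> K"
    by (rule h.FactGroup_iso[OF onto])
  then have "K \<cong> ?F Mod ?R"
    using group.iso_sym[OF normal.factorgroup_is_group[OF h.normal_kernel]] by blast
  moreover have "|?R| \<le>o \<kappa>"
    by (rule ordLeq_transitive[OF card_of_mono1 card_free_Abelian_group[OF \<kappa> K(2)]])
      (auto simp: kernel_def)
  moreover have "?R \<subseteq> carrier ?F"
    by (auto simp: kernel_def)
  ultimately show ?thesis
    unfolding less_presented_def using R K(2) ordLess_cardSuc_iff[OF \<kappa>(1) \<mu>] by metis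
qed

text \<open>The bound is not strict because \<open>\<kappa>\<close> may be countable, and a finitely
  presented group such as the infinite cyclic one can be infinite.\<close>

lemma less_presented_card:
  fixes K :: "'v::zfc monoid"
  assumes "less_presented \<kappa> K" and \<kappa>: "Card_order \<kappa>" "natLeq \<le>o \<kappa>"
  shows "|carrier K| \<le>o \<kappa>"
proof -
  obtain Y :: "'v set" and R where Y: "|Y| <o \<kappa>"
    and K: "K \<cong> free_Abelian_group Y Mod generate (free_Abelian_group Y) R"
    using assms(1) unfolding less_presented_def by blast
  let ?F = "free_Abelian_group Y"
  let ?Q = "?F Mod generate ?F R"
  have "|carrier K| =o |carrier ?Q|"
    using iso_imp_eqpoll_carrier[OF K] by (simp add: eqpoll_iff_card_of_ordIso)
  also have "|carrier ?Q| \<le>o |carrier ?F|"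
    by (simp add: carrier_FactGroup)
  also have "|carrier ?F| \<le>o \<kappa>"
    by (rule card_free_Abelian_group[OF \<kappa> ordLess_imp_ordLeq[OF Y]])
  finally show ?thesis .
qed

subsection \<open>Filtrations\<close>

lemma Well_order_cases:
  assumes "i \<in> Field r"
  obtains (zero) "underS r i = {}" | (succ) k where "is_succ r k i" | (limit) "is_limit r i"
  using assms unfolding is_limit_def by blast

lemma is_succ_underS:
  assumes "Well_order r" "is_succ r i j"
  shows "i \<in> underS r j" "(i, j) \<in> r"
proof -
  have "Refl r"
    using assms(1) by (simp add: order_on_defs)
  then show "i \<in> underS r j"
    using assms(2) Refl_under_in[of r i] unfolding is_succ_def by auto
  then show "(i, j) \<in> r"
    by (simp add: underS_def)
qed

text \<open>By transfinite induction a homomorphism to the integers vanishes on every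
  \<open>N i\<close>: successor steps use \<open>perp_Z_extension\<close>, limit steps use
  continuity.\<close>

lemma perp_Z_filtration:
  fixes M :: "'v::zfc monoid"
  assumes M: "comm_group M" and N: "filtration \<K> M r N" "carrier M = (\<Union>i\<in>Field r. N i)"
    and \<K>: "\<And>K. K \<in> \<K> \<Longrightarrow> K \<in> ab_groups \<and> perp_Z K"
  shows "perp_Z M"
  unfolding perp_Z_def
proof (intro ballI)
  fix f a assume f: "f \<in> hom M integer_group" and a: "a \<in> carrier M"
  interpret M: comm_group M by fact
  have wo: "Well_order r"
    using N(1) unfolding filtration_def by blast
  then have wo_rel: "wo_rel r"
    by (simp add: wo_rel_def)
  have f1: "f \<one>\<^bsub>M\<^esub> = 0"
    using hom_integer_group_add[OF f, of "\<one>\<^bsub>M\<^esub>" "\<one>\<^bsub>M\<^esub>"] by simp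
  have "i \<in> Field r \<longrightarrow> (\<forall>x\<in>N i. f x = 0)" for i
  proof (induction i rule: wo_rel.well_order_induct[OF wo_rel], intro impI ballI)
    fix i x
    assume IH: "\<forall>y. y \<noteq> i \<and> (y, i) \<in> r \<longrightarrow> y \<in> Field r \<longrightarrow> (\<forall>x\<in>N y. f x = 0)"
      and i: "i \<in> Field r" and x: "x \<in> N i"
    have IH': "f z = 0" if "k \<in> underS r i" "z \<in> N k" for k z
      using IH that by (auto simp: underS_def Field_def)
    from i show "f x = 0"
    proof (cases rule: Well_order_cases)
      case zero
      then have "x = \<one>\<^bsub>M\<^esub>"
        using N(1) i x unfolding filtration_def by blast
      then show ?thesis
        using f1 by simp
    next
      case (succ k)
      let ?G = "M\<lparr>carrier := N i\<rparr>"
      have k: "k \<in> Field r" "(k, i) \<in> r" "k \<in> underS r i"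
        using succ is_succ_underS[OF wo succ] unfolding is_succ_def by auto
      have sub: "subgroup (N k) M" "subgroup (N i) M" "N k \<subseteq> N i"
        using N(1) k i unfolding filtration_def by blast+
      obtain K where K: "K \<in> \<K>" "?G Mod N k \<cong> K"
        using N(1) succ unfolding filtration_def by blast
      have normal: "N k \<lhd> ?G"
        by (rule subgroup_normal_in[OF M sub])
      then have "K \<cong> ?G Mod N k"
        using K(2) group.iso_sym normal.factorgroup_is_group by blast
      then have perp: "perp_Z (?G Mod N k)"
        using perp_Z_iso \<K>[OF K(1)] by blast
      show ?thesis
        using perp_Z_extension[OF _ normal perp hom_integer_group_restrict[OF f]] IH'[OF k(3)]
          M.subgroup_imp_group[OF sub(2)] subgroup.subset[OF sub(2)] x
        by auto
    next
      case limit
      then have "N i = (\<Union>k\<in>underS r i. N k)"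
        using N(1) unfolding filtration_def by blast
      then show ?thesis
        using IH' x by blast
    qed
  qed
  then show "f a = 0"
    using N(2) a by auto
qed

text \<open>The first nonzero member of a filtration is isomorphic to a member of the filtered class.\<close>

lemma Filt_nontrivial_subgroup:
  fixes M :: "'v::zfc monoid"
  assumes M: "M \<in> Filt \<K>" "carrier M \<noteq> {\<one>\<^bsub>M\<^esub>}"
  obtains B K where "subgroup B M" "B \<noteq> {\<one>\<^bsub>M\<^esub>}" "K \<in> \<K>" "M\<lparr>carrier := B\<rparr> \<cong> K"
proof -
  obtain r N where N: "filtration \<K> M r N" "carrier M = (\<Union>i\<in>Field r. N i)" and cM: "comm_group M"
    using M(1) unfolding Filt_def ab_groups_def by blast
  interpret M: comm_group M by fact
  have wo: "Well_order r"
    using N(1) unfolding filtration_def by blast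
  then have wo_rel: "wo_rel r"
    by (simp add: wo_rel_def)
  have sub: "subgroup (N i) M" if "i \<in> Field r" for i
    using N(1) that unfolding filtration_def by blast
  have one: "\<one>\<^bsub>M\<^esub> \<in> N i" if "i \<in> Field r" for i
    using sub[OF that] by (rule subgroup.one_closed)
  have ex: "\<exists>i. i \<in> Field r \<and> N i \<noteq> {\<one>\<^bsub>M\<^esub>}"
    using M(2) N(2) M.one_closed by (metis (no_types, lifting) UN_E UN_I equalityI singletonD subsetI)
  define P where "P i \<longleftrightarrow> i \<in> Field r \<and> N i \<noteq> {\<one>\<^bsub>M\<^esub>}" for i
  \<comment> \<open>The least index with a nonzero member must be a successor, because the first
    member is zero and a limit of zero groups is zero.\<close>
  have "\<exists>j. P j \<and> (\<forall>k\<in>underS r j. \<not> P k)"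
  proof (rule ccontr)
    assume *: "\<nexists>j. P j \<and> (\<forall>k\<in>underS r j. \<not> P k)"
    have "\<not> P i" for i
      by (induction i rule: wo_rel.well_order_induct[OF wo_rel]) (use * in \<open>auto simp: underS_def\<close>)
    then show False
      using ex unfolding P_def by blast
  qed
  then obtain j where j: "j \<in> Field r" "N j \<noteq> {\<one>\<^bsub>M\<^esub>}"
    and min: "\<And>k. k \<in> underS r j \<Longrightarrow> N k = {\<one>\<^bsub>M\<^esub>}"
    using underS_Field unfolding P_def by fast
  from j(1) show ?thesis
  proof (cases rule: Well_order_cases)
    case zero
    then show ?thesis
      using N(1) j unfolding filtration_def by blast
  next
    case limit
    then have "N j = (\<Union>k\<in>underS r j. N k)" "underS r j \<noteq> {}"
      using N(1) unfolding filtration_def is_limit_def by blast+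
    then show ?thesis
      using min j(2) by auto
  next
    case (succ k)
    let ?G = "M\<lparr>carrier := N j\<rparr>"
    have k: "N k = {\<one>\<^bsub>M\<^esub>}"
      using min is_succ_underS[OF wo succ] by blast
    then obtain K where K: "K \<in> \<K>" "?G Mod {\<one>\<^bsub>M\<^esub>} \<cong> K"
      using N(1) succ unfolding filtration_def by metis
    interpret G: comm_group ?G
      by (rule subgroup_comm_group[OF cM sub[OF j(1)]])
    have triv: "{\<one>\<^bsub>M\<^esub>} \<lhd> ?G"
      using G.triv_subgroup by (simp add: G.normal_iff_subgroup)
    \<comment> \<open>The predecessor \<open>N k\<close> is trivial, so its cosets are singletons
      and the quotient is a copy of \<open>N j\<close> itself.\<close>
    have coset: "{\<one>\<^bsub>M\<^esub>} #>\<^bsub>?G\<^esub> x = {x}" if "x \<in> N j" for x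
      using that subgroup.subset[OF sub[OF j(1)]] by (auto simp: r_coset_def)
    have "(\<lambda>x. {\<one>\<^bsub>M\<^esub>} #>\<^bsub>?G\<^esub> x) \<in> iso ?G (?G Mod {\<one>\<^bsub>M\<^esub>})"
      using normal.r_coset_hom_Mod[OF triv] coset
      by (auto simp: iso_def bij_betw_def inj_on_def carrier_FactGroup)
    then have "?G \<cong> K"
      using K(2) iso_trans unfolding is_iso_def by blast
    then show ?thesis
      using that sub[OF j(1)] j(2) K(1) by blast
  qed
qed

subsection \<open>From strong compactness to deconstructibility\<close>

lemma complete_family_countable:
  assumes "complete_family omega1 \<U>" "\<S> \<subseteq> \<U>" "\<S> \<noteq> {}" "countable \<S>"
  shows "\<Inter>\<S> \<in> \<U>"
proof -
  have "|\<S>| <o omega1"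
    using assms(4) cardSuc_ordLeq_ordLess[OF natLeq_Card_order card_of_Card_order[of \<S>]]
    by (simp add: countable_card_le_natLeq)
  then show ?thesis
    using assms(1-3) unfolding complete_family_def by simp
qed

text \<open>If no fibre of \<open>g\<close> were in the ultrafilter, all complements of fibres would
  be. These are countably many sets with empty intersection.\<close>

lemma ultrafilter_constant_value:
  fixes g :: "'a \<Rightarrow> 'b::countable"
  assumes \<U>: "ultrafilter_on Y \<U>" "complete_family omega1 \<U>"
  shows "\<exists>n. {y\<in>Y. g y = n} \<in> \<U>"
proof (rule ccontr)
  assume neg: "\<nexists>n. {y\<in>Y. g y = n} \<in> \<U>"
  have "{y\<in>Y. g y = n} \<in> \<U> \<or> Y - {y\<in>Y. g y = n} \<in> \<U>" for n
    using \<U>(1) unfolding ultrafilter_on_def by (metis (no_types, lifting) mem_Collect_eq subsetI)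
  then have "Y - {y\<in>Y. g y = n} \<in> \<U>" for n
    using neg by auto
  then have "(\<Inter>n. Y - {y\<in>Y. g y = n}) \<in> \<U>"
    by (intro complete_family_countable[OF \<U>(2)]) auto
  moreover have "(\<Inter>n. Y - {y\<in>Y. g y = n}) = {}"
    by auto
  ultimately show False
    using \<U>(1) unfolding ultrafilter_on_def filter_on_def by metis
qed

lemma omega1_strongly_compact_subgroup_kill:
  fixes A :: "'v::zfc monoid" and \<kappa> :: "'v rel"
  assumes \<kappa>: "omega1_strongly_compact \<kappa>" and A: "A \<in> ab_groups" "perp_Z A" and a: "a \<in> carrier A"
  shows "\<exists>B. subgroup B A \<and> a \<in> B \<and> |B| \<le>o \<kappa> \<and>
    (\<forall>f\<in>hom (A\<lparr>carrier := B\<rparr>) integer_group. f a = 0)"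
proof (rule ccontr)
  assume neg: "\<not> ?thesis"
  have co: "Card_order \<kappa>" and leq: "natLeq \<le>o \<kappa>"
    using \<kappa> ordLess_imp_ordLeq unfolding omega1_strongly_compact_def cardinal_def by auto
  have inf: "infinite (Field \<kappa>)"
    by (rule infinite_Field_of_natLeq[OF leq])
  have G: "comm_group A" and sm: "small (carrier A)"
    using A(1) unfolding ab_groups_def by auto
  \<comment> \<open>The index set consists of codes of subgroups, since the compactness hypothesis
    concerns filters on small sets of elements.\<close>
  define Y where "Y = {b. subgroup (elts b) A \<and> a \<in> elts b \<and> |elts b| \<le>o \<kappa>}"
  have Ysub: "Y \<subseteq> {b. elts b \<subseteq> carrier A}"
    unfolding Y_def using subgroup.subset by auto
  then have smY: "small Y"
    using small_subset[OF small_Collect_elts[OF sm]] by blast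
  have "\<exists>f. f \<in> hom (A\<lparr>carrier := elts b\<rparr>) integer_group \<and> f a \<noteq> 0" if "b \<in> Y" for b
    using neg that unfolding Y_def by blast
  then obtain \<phi> where \<phi>: "\<And>b. b \<in> Y \<Longrightarrow> \<phi> b \<in> hom (A\<lparr>carrier := elts b\<rparr>) integer_group"
      "\<And>b. b \<in> Y \<Longrightarrow> \<phi> b a \<noteq> 0"
    by metis
  \<comment> \<open>The cones over sets of size at most \<open>\<kappa>\<close> generate
    \<open>\<F>\<close>. Completeness holds because a union of at most \<open>\<kappa>\<close> such
    sets is again one.\<close>
  define cone where "cone C = {b\<in>Y. C \<subseteq> elts b}" for C
  define \<F> where "\<F> = {X. X \<subseteq> Y \<and> (\<exists>C. C \<subseteq> carrier A \<and> |C| \<le>o \<kappa> \<and> cone C \<subseteq> X)}"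
  have singl: "|{x}| \<le>o \<kappa>" for x :: 'v
    using card_of_singl_ordLeq[of "Field \<kappa>"] inf card_of_Field_ordIso[OF co] ordLeq_ordIso_trans
    by (metis finite.emptyI)
  have cone_ne: "cone C \<noteq> {}" if C: "C \<subseteq> carrier A" "|C| \<le>o \<kappa>" for C
  proof -
    have "|insert a C| \<le>o \<kappa>"
      using card_of_Un_ordLeq_infinite_Field[OF inf singl C(2) co] by simp
    then obtain H where H: "subgroup H A" "insert a C \<subseteq> H" "|H| \<le>o \<kappa>"
      using subgroup_cover[OF G _ _ co leq, of "insert a C"] a C(1) by blast
    obtain b where "elts b = H"
      using small_elts_ex[OF sm subgroup.subset[OF H(1)]] by blast
    then show ?thesis
      using H unfolding cone_def Y_def by blast
  qed
  have UN_le: "|\<Union>i\<in>I. C i| \<le>o \<kappa>" if "|I| \<le>o \<kappa>" "\<And>i. i \<in> I \<Longrightarrow> |C i| \<le>o \<kappa>"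
    for I :: "'v set set" and C :: "'v set \<Rightarrow> 'v set"
    using card_of_UNION_ordLeq_infinite_Field[OF inf co that(1), of C] that(2) by simp
  have "filter_on Y \<F>"
    unfolding filter_on_def
  proof (intro conjI ballI allI impI)
    show "Y \<in> \<F>"
      unfolding \<F>_def cone_def using card_of_empty1[of \<kappa>] co by (auto intro!: exI[of _ "{}"])
    show "{} \<notin> \<F>"
      unfolding \<F>_def using cone_ne by blast
  next
    fix X Z assume "X \<in> \<F>" "Z \<in> \<F>"
    then obtain C D where C: "X \<subseteq> Y" "C \<subseteq> carrier A" "|C| \<le>o \<kappa>" "cone C \<subseteq> X"
      and D: "D \<subseteq> carrier A" "|D| \<le>o \<kappa>" "cone D \<subseteq> Z"
      unfolding \<F>_def by blast
    have "|C \<union> D| \<le>o \<kappa>"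
      by (rule card_of_Un_ordLeq_infinite_Field[OF inf C(3) D(2) co])
    moreover have "cone (C \<union> D) \<subseteq> X \<inter> Z"
      using C(4) D(3) unfolding cone_def by blast
    moreover have "X \<inter> Z \<subseteq> Y" "C \<union> D \<subseteq> carrier A"
      using C(1,2) D(1) by auto
    ultimately show "X \<inter> Z \<in> \<F>"
      unfolding \<F>_def by (intro CollectI conjI exI[of _ "C \<union> D"])
  next
    fix X Z assume "X \<in> \<F>" and Z: "X \<subseteq> Z \<and> Z \<subseteq> Y"
    then obtain C where "C \<subseteq> carrier A" "|C| \<le>o \<kappa>" "cone C \<subseteq> X"
      unfolding \<F>_def by auto
    then show "Z \<in> \<F>"
      using Z unfolding \<F>_def by (intro CollectI conjI exI[of _ C]) auto
  qed (auto simp: \<F>_def)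
  moreover have "complete_family \<kappa> \<F>"
    unfolding complete_family_def
  proof (intro allI impI, elim conjE)
    fix \<S> assume \<S>: "\<S> \<subseteq> \<F>" "\<S> \<noteq> {}" "|\<S>| <o \<kappa>"
    have "\<forall>X\<in>\<S>. \<exists>C. C \<subseteq> carrier A \<and> |C| \<le>o \<kappa> \<and> cone C \<subseteq> X"
      using \<S>(1) unfolding \<F>_def by auto
    then obtain C where C: "\<And>X. X \<in> \<S> \<Longrightarrow> C X \<subseteq> carrier A \<and> |C X| \<le>o \<kappa> \<and> cone (C X) \<subseteq> X"
      by metis
    have "|\<Union>X\<in>\<S>. C X| \<le>o \<kappa>"
      using UN_le[OF ordLess_imp_ordLeq[OF \<S>(3)]] C by blast
    moreover have "cone (\<Union>X\<in>\<S>. C X) \<subseteq> \<Inter>\<S>"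
      using C unfolding cone_def by blast
    moreover have "\<Inter>\<S> \<subseteq> Y"
      using \<S>(1,2) unfolding \<F>_def by blast
    moreover have "(\<Union>X\<in>\<S>. C X) \<subseteq> carrier A"
      using C by blast
    ultimately show "\<Inter>\<S> \<in> \<F>"
      unfolding \<F>_def by (intro CollectI conjI exI[of _ "\<Union>X\<in>\<S>. C X"])
  qed
  ultimately obtain \<U> where \<U>: "ultrafilter_on Y \<U>" "complete_family omega1 \<U>" "\<F> \<subseteq> \<U>"
    using \<kappa> smY unfolding omega1_strongly_compact_def by meson
  have Int: "X \<inter> Z \<in> \<U>" if "X \<in> \<U>" "Z \<in> \<U>" for X Z
    using \<U>(1) that unfolding ultrafilter_on_def filter_on_def by simp
  have "{} \<notin> \<U>"
    using \<U>(1) unfolding ultrafilter_on_def filter_on_def by simp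
  then have ne: "\<exists>b. b \<in> X" if "X \<in> \<U>" for X
    using that by (metis equals0I)
  have "\<exists>n. {b\<in>Y. \<phi> b x = n} \<in> \<U>" for x
    by (rule ultrafilter_constant_value[OF \<U>(1,2)])
  \<comment> \<open>The limit homomorphism: \<open>f x\<close> is the value that
    \<open>\<phi> b x\<close> takes for almost all \<open>b\<close>. It exists because the integers
    are countable.\<close>
  then obtain f where f: "\<And>x. {b\<in>Y. \<phi> b x = f x} \<in> \<U>"
    by metis
  \<comment> \<open>Almost every \<open>b\<close> contains \<open>x\<close>; only for such
    \<open>b\<close> does \<open>\<phi> b x\<close> carry information.\<close>
  have mem: "{b\<in>Y. x \<in> elts b} \<in> \<U>" if "x \<in> carrier A" for x
  proof -
    have "cone {x} \<in> \<F>"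
      unfolding \<F>_def using that singl by (auto simp: cone_def)
    then show ?thesis
      using \<U>(3) unfolding cone_def by auto
  qed
  have "f \<in> hom A integer_group"
  proof (rule hom_integer_groupI)
    fix x y assume x: "x \<in> carrier A" and y: "y \<in> carrier A"
    \<comment> \<open>Any point common to these five large sets transfers the additivity of
      \<open>\<phi> b\<close> to \<open>f\<close> at \<open>x\<close> and \<open>y\<close>.\<close>
    obtain b where "b \<in> {b\<in>Y. \<phi> b x = f x} \<inter> {b\<in>Y. \<phi> b y = f y} 
        \<inter> {b\<in>Y. \<phi> b (x \<otimes>\<^bsub>A\<^esub> y) = f (x \<otimes>\<^bsub>A\<^esub> y)} \<inter> {b\<in>Y. x \<in> elts b} \<inter> {b\<in>Y. y \<in> elts b}"
      using ne[OF Int[OF Int[OF Int[OF Int[OF f f] f] mem[OF x]] mem[OF y]]] by blast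
    then show "f (x \<otimes>\<^bsub>A\<^esub> y) = f x + f y"
      using hom_integer_group_add[OF \<phi>(1), of b x y] by simp
  qed
  then have "f a = 0"
    using A(2) a unfolding perp_Z_def by blast
  then show False
    using ne[OF f[of a]] \<phi>(2) by auto
qed

lemma subgroup_UN_chain:
  fixes G (structure)
  assumes G: "group G" and I: "I \<noteq> {}" and H: "\<And>i. i \<in> I \<Longrightarrow> subgroup (H i) G"
    and chain: "\<And>i j. i \<in> I \<Longrightarrow> j \<in> I \<Longrightarrow> H i \<subseteq> H j \<or> H j \<subseteq> H i"
  shows "subgroup (\<Union>i\<in>I. H i) G"
proof -
  interpret group G by fact
  show ?thesis
  proof (rule subgroupI)
    show "(\<Union>i\<in>I. H i) \<subseteq> carrier G"
      using H subgroup.subset by blast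
    show "(\<Union>i\<in>I. H i) \<noteq> {}"
      using I H subgroup.one_closed by blast
    show "inv x \<in> (\<Union>i\<in>I. H i)" if "x \<in> (\<Union>i\<in>I. H i)" for x
      using that subgroup.m_inv_closed[OF H] by auto
    show "x \<otimes> y \<in> (\<Union>i\<in>I. H i)" if xy: "x \<in> (\<Union>i\<in>I. H i)" "y \<in> (\<Union>i\<in>I. H i)" for x y
    proof -
      obtain i j where ij: "i \<in> I" "x \<in> H i" "j \<in> I" "y \<in> H j"
        using xy by blast
      then obtain k where k: "k \<in> I" "x \<in> H k" "y \<in> H k"
        using chain[of i j] by blast
      then have "x \<otimes> y \<in> H k"
        using subgroup.m_closed[OF H] by blast
      then show ?thesis
        using k(1) by blast
    qed
  qed
qed

text \<open>The subgroup \<open>\<beta> x\<close> is only known to kill the single element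
  \<open>x\<close>. Iterating \<open>\<omega>\<close> times yields a subgroup \<open>B\<close> that
  contains \<open>\<beta> x\<close> for each of its elements \<open>x\<close>, and restriction to
  \<open>\<beta> x\<close> then kills every \<open>x\<close>.\<close>

lemma omega1_strongly_compact_perp_cover:
  fixes A :: "'v::zfc monoid" and \<kappa> :: "'v rel"
  assumes \<kappa>: "omega1_strongly_compact \<kappa>" and A: "A \<in> ab_groups" "perp_Z A" and a: "a \<in> carrier A"
  shows "\<exists>B. subgroup B A \<and> a \<in> B \<and> |B| \<le>o \<kappa> \<and> perp_Z (A\<lparr>carrier := B\<rparr>)"
proof -
  have co: "Card_order \<kappa>" and leq: "natLeq \<le>o \<kappa>"
    using \<kappa> ordLess_imp_ordLeq unfolding omega1_strongly_compact_def cardinal_def by auto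
  have inf: "infinite (Field \<kappa>)"
    by (rule infinite_Field_of_natLeq[OF leq])
  have G: "comm_group A"
    using A(1) unfolding ab_groups_def by auto
  interpret comm_group A by fact
  obtain \<beta> where \<beta>: "\<And>x. x \<in> carrier A \<Longrightarrow> subgroup (\<beta> x) A \<and> x \<in> \<beta> x \<and> |\<beta> x| \<le>o \<kappa> \<and>
      (\<forall>f\<in>hom (A\<lparr>carrier := \<beta> x\<rparr>) integer_group. f x = 0)"
    using omega1_strongly_compact_subgroup_kill[OF \<kappa> A] by metis
  have "\<forall>S. \<exists>T. subgroup S A \<and> |S| \<le>o \<kappa> \<longrightarrow> subgroup T A \<and> |T| \<le>o \<kappa> \<and> (\<Union>x\<in>S. \<beta> x) \<subseteq> T"
  proof
    fix S show "\<exists>T. subgroup S A \<and> |S| \<le>o \<kappa> \<longrightarrow> subgroup T A \<and> |T| \<le>o \<kappa> \<and> (\<Union>x\<in>S. \<beta> x) \<subseteq> T"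
    proof (cases "subgroup S A \<and> |S| \<le>o \<kappa>")
      case True
      then have S: "subgroup S A" "|S| \<le>o \<kappa>" by auto
      then have sub: "x \<in> carrier A" if "x \<in> S" for x
        using that subgroup.subset by blast
      then have "|\<Union>x\<in>S. \<beta> x| \<le>o \<kappa>"
        using card_of_UNION_ordLeq_infinite_Field[OF inf co S(2)] \<beta> by blast
      moreover have "(\<Union>x\<in>S. \<beta> x) \<subseteq> carrier A"
        using \<beta> sub subgroup.subset by blast
      ultimately show ?thesis
        using subgroup_cover[OF G _ _ co leq] by blast
    qed blast
  qed
  then obtain T where T: "\<And>S. subgroup S A \<Longrightarrow> |S| \<le>o \<kappa> \<Longrightarrow>
      subgroup (T S) A \<and> |T S| \<le>o \<kappa> \<and> (\<Union>x\<in>S. \<beta> x) \<subseteq> T S"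
    by metis
  define S where "S n = (T ^^ n) (\<beta> a)" for n
  have S: "subgroup (S n) A \<and> |S n| \<le>o \<kappa>" for n
    unfolding S_def using T \<beta>[OF a] by (induction n) auto
  have step: "\<beta> x \<subseteq> S (Suc n)" if "x \<in> S n" for n x
    using T[of "S n"] S[of n] that unfolding S_def by auto
  have S_Suc: "S n \<subseteq> S (Suc n)" for n
    using step \<beta> S[of n] subgroup.subset by blast
  then have mono: "S m \<subseteq> S n" if "m \<le> n" for m n
    using that by (rule lift_Suc_mono_le)
  define B where "B = (\<Union>n. S n)"
  have B: "subgroup B A"
    unfolding B_def
  proof (rule subgroup_UN_chain)
    show "S m \<subseteq> S n \<or> S n \<subseteq> S m" for m n
      using mono[of m n] mono[of n m] by (cases "m \<le> n") auto
  qed (use S is_group in auto)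
  have "a \<in> B"
    unfolding B_def S_def using \<beta>[OF a] by (auto intro!: exI[of _ 0])
  moreover have "|B| \<le>o \<kappa>"
    unfolding B_def
    using card_of_UNION_ordLeq_infinite_Field[OF inf co, of "UNIV :: nat set" S] S leq
      card_of_nat ordIso_ordLeq_trans by blast
  moreover have "perp_Z (A\<lparr>carrier := B\<rparr>)"
    unfolding perp_Z_def
  proof (intro ballI)
    fix f x assume f: "f \<in> hom (A\<lparr>carrier := B\<rparr>) integer_group" and "x \<in> carrier (A\<lparr>carrier := B\<rparr>)"
    then obtain n where n: "x \<in> S n"
      unfolding B_def by auto
    then have x: "x \<in> carrier A"
      using S subgroup.subset by blast
    have "\<beta> x \<subseteq> B"
      using step[OF n] unfolding B_def by blast
    then have "f \<in> hom (A\<lparr>carrier := \<beta> x\<rparr>) integer_group"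
      using hom_integer_group_restrict[OF f, of "\<beta> x"] by simp
    then show "f x = 0"
      using \<beta>[OF x] by blast
  qed
  ultimately show ?thesis
    using B by blast
qed

text \<open>\<open>N i\<close> is generated by the subgroups \<open>\<beta> k\<close> with
  \<open>k\<close> before \<open>i\<close>. The quotient at a successor step is an image of
  \<open>\<beta> i\<close>, so it is small and inherits \<open>perp_Z\<close>.\<close>

lemma Filt_of_perp_cover:
  fixes A :: "'v::zfc monoid" (structure)
  assumes A: "A \<in> ab_groups" and \<kappa>: "Card_order \<kappa>" "natLeq \<le>o \<kappa>" "\<mu> =o cardSuc \<kappa>"
    and cover: "\<And>a. a \<in> carrier A \<Longrightarrow>
      \<exists>B. subgroup B A \<and> a \<in> B \<and> |B| \<le>o \<kappa> \<and> perp_Z (A\<lparr>carrier := B\<rparr>)"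
  shows "A \<in> Filt {M \<in> left_perp0 integer_group. less_presented \<mu> M}"
proof -
  have G: "comm_group A" and sm: "small (carrier A)"
    using A unfolding ab_groups_def by auto
  interpret comm_group A by fact
  \<comment> \<open>Indices outside the carrier also need a subgroup; the one covering the unit
    serves as a default.\<close>
  have "\<exists>B. subgroup B A \<and> |B| \<le>o \<kappa> \<and> perp_Z (A\<lparr>carrier := B\<rparr>) \<and> (x \<in> carrier A \<longrightarrow> x \<in> B)" for x
    using cover[of x] cover[of \<one>] by (cases "x \<in> carrier A") auto
  then obtain \<beta> where \<beta>: "\<And>x. subgroup (\<beta> x) A" "\<And>x. |\<beta> x| \<le>o \<kappa>" "\<And>x. perp_Z (A\<lparr>carrier := \<beta> x\<rparr>)"
      "\<And>x. x \<in> carrier A \<Longrightarrow> x \<in> \<beta> x"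
    by metis
  have \<beta>_sub: "\<beta> x \<subseteq> carrier A" for x
    using \<beta>(1) subgroup.subset by blast
  obtain W :: "'v set" where W: "small W" "infinite W"
    using infinite_small_exists by blast
  \<comment> \<open>Adding \<open>W\<close> makes the field infinite, so this cardinal order has no
    last element. This matters because \<open>N j\<close> collects only indices strictly before
    \<open>j\<close>.\<close>
  define r where "r = |carrier A \<union> W|"
  have co: "Card_order r" and Fr: "Field r = carrier A \<union> W"
    unfolding r_def by auto
  then have wo: "Well_order r"
    unfolding card_order_on_def by blast
  have refl: "Refl r" and tr: "trans r" and antisym: "antisym r" and total: "Total r"
    using wo by (auto simp: order_on_defs)
  have no_max: "\<exists>j\<in>Field r. x \<noteq> j \<and> (x, j) \<in> r" if "x \<in> Field r" for x
    using infinite_Card_order_limit[OF co] that W(2) Fr by auto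
  define N where "N i = generate A (\<Union>k\<in>underS r i. \<beta> k)" for i
  have N_sub: "subgroup (N i) A" for i
    unfolding N_def using \<beta>_sub by (intro generate_is_subgroup) blast
  have \<beta>_N: "\<beta> k \<subseteq> N i" if "k \<in> underS r i" for k i
    unfolding N_def using that by (auto intro: generate.incl)
  have N_least: "N i \<subseteq> H" if "subgroup H A" "\<And>k. k \<in> underS r i \<Longrightarrow> \<beta> k \<subseteq> H" for i H
    unfolding N_def using that by (intro generate_subgroup_incl) auto
  have N_mono: "N i \<subseteq> N j" if "(i, j) \<in> r" for i j
    unfolding N_def using underS_incr[OF tr antisym that] by (intro mono_generate) blast
  have "filtration {M \<in> left_perp0 integer_group. less_presented \<mu> M} A r N"
    unfolding filtration_def
  proof (intro conjI ballI allI impI)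
    show "Well_order r" by fact
    show "small (Field r)"
      unfolding Fr by (rule small_Un[OF sm W(1)])
    show "subgroup (N i) A" for i
      by (rule N_sub)
    show "N i \<subseteq> N j" if "(i, j) \<in> r" for i j
      using that by (rule N_mono)
    show "N i = {\<one>}" if "underS r i = {}" for i
      unfolding N_def that by (simp add: generate_empty)
    show "N j = (\<Union>i\<in>underS r j. N i)" if lim: "is_limit r j" for j
    proof
      have j: "j \<in> Field r" "underS r j \<noteq> {}"
        using lim unfolding is_limit_def by auto
      show "(\<Union>i\<in>underS r j. N i) \<subseteq> N j"
        using N_mono by (auto simp: underS_def)
      show "N j \<subseteq> (\<Union>i\<in>underS r j. N i)"
      proof (rule N_least)
        show "subgroup (\<Union>i\<in>underS r j. N i) A"
        proof (rule subgroup_UN_chain)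
          fix i k assume ik: "i \<in> underS r j" "k \<in> underS r j"
          then have "i = k \<or> (i, k) \<in> r \<or> (k, i) \<in> r"
            using total underS_Field[OF ik(1)] underS_Field[OF ik(2)] unfolding total_on_def by blast
          then show "N i \<subseteq> N k \<or> N k \<subseteq> N i"
            using N_mono by blast
        qed (use j N_sub is_group in auto)
        fix k assume k: "k \<in> underS r j"
        then have kF: "k \<in> Field r"
          using underS_Field by fast
        \<comment> \<open>As \<open>k\<close> is not an immediate predecessor of the limit
          \<open>j\<close>, some \<open>i\<close> lies strictly between them, and
          \<open>\<beta> k\<close> is already contained in \<open>N i\<close>.\<close>
        have "underS r j \<noteq> under r k"
          using lim kF j(1) unfolding is_limit_def is_succ_def by blast
        moreover have "under r k \<subseteq> underS r j"
          using k tr antisym unfolding under_def underS_def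
          by (auto dest: transD antisymD)
        ultimately obtain i where i: "i \<in> underS r j" "i \<notin> under r k"
          by blast
        have "(i, k) \<notin> r" "i \<noteq> k"
          using i(2) refl kF by (auto simp: under_def refl_on_def)
        then have "k \<in> underS r i"
          using total kF underS_Field[OF i(1)] by (auto simp: total_on_def underS_def)
        then show "\<beta> k \<subseteq> (\<Union>i\<in>underS r j. N i)"
          using \<beta>_N i(1) by blast
      qed
    qed
    fix i j assume succ: "is_succ r i j"
    have ij: "i \<in> underS r j" "(i, j) \<in> r"
      using is_succ_underS[OF wo succ] by auto
    have under_j: "underS r j = underS r i \<union> {i}"
      using succ Refl_under_underS[OF refl] unfolding is_succ_def by metis
    have NjNi: "N j \<subseteq> N i <#> \<beta> i"
    proof (rule N_least)
      show "subgroup (N i <#> \<beta> i) A"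
        by (rule mult_subgroups[OF N_sub \<beta>(1)])
      fix k assume "k \<in> underS r j"
      then consider "k \<in> underS r i" | "k = i"
        using under_j by blast
      then show "\<beta> k \<subseteq> N i <#> \<beta> i"
      proof cases
        case 1
        then have "x \<in> N i \<and> x = x \<otimes> \<one>" if "x \<in> \<beta> k" for x
          using \<beta>_N[OF 1] that subsetD[OF \<beta>_sub that] by auto
        then show ?thesis
          using subgroup.one_closed[OF \<beta>(1)[of i]] unfolding set_mult_def by blast
      next
        case 2
        then have "x \<in> \<beta> i \<and> x = \<one> \<otimes> x" if "x \<in> \<beta> k" for x
          using that subsetD[OF \<beta>_sub that] 2 by auto
        then show ?thesis
          using subgroup.one_closed[OF N_sub[of i]] unfolding set_mult_def by blast
      qed
    qed
    let ?G = "A\<lparr>carrier := N j\<rparr>"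
    let ?Q = "?G Mod N i"
    have normal: "N i \<lhd> ?G"
      by (rule subgroup_normal_in[OF G N_sub N_sub N_mono[OF ij(2)]])
    interpret Gj: comm_group ?G
      by (rule subgroup_comm_group[OF G N_sub])
    have Q: "comm_group ?Q"
      by (rule Gj.abelian_FactGroup[OF normal_imp_subgroup[OF normal]])
    \<comment> \<open>By \<open>NjNi\<close>, every coset of \<open>N i\<close> in
      \<open>N j\<close> has a representative in \<open>\<beta> i\<close>, so this map is onto
      already on \<open>\<beta> i\<close>.\<close>
    define g where "g b = N i #>\<^bsub>?G\<^esub> b" for b
    have \<beta>j: "\<beta> i \<subseteq> N j"
      by (rule \<beta>_N[OF ij(1)])
    have "g \<in> hom ?G ?Q"
      unfolding g_def by (rule normal.r_coset_hom_Mod[OF normal])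
    then have g_hom: "g \<in> hom (A\<lparr>carrier := \<beta> i\<rparr>) ?Q"
      using \<beta>j by (simp add: hom_def subset_iff Pi_iff)
    have g_onto: "g ` \<beta> i = carrier ?Q"
    proof
      show "g ` \<beta> i \<subseteq> carrier ?Q"
        using \<beta>j by (auto simp: g_def carrier_FactGroup)
      show "carrier ?Q \<subseteq> g ` \<beta> i"
      proof
        fix q assume "q \<in> carrier ?Q"
        then obtain x where x: "x \<in> N j" "q = N i #> x"
          by (auto simp: carrier_FactGroup r_coset_def)
        then obtain n b where nb: "n \<in> N i" "b \<in> \<beta> i" "x = n \<otimes> b"
          using NjNi unfolding set_mult_def by blast
        have "N i #> n = N i"
          using coset_join2[OF _ N_sub nb(1)] nb(1) subgroup.subset[OF N_sub] by blast
        then have "N i #> x = N i #> b"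
          using coset_mult_assoc[of "N i" n b] nb subgroup.subset[OF N_sub]
            subsetD[OF subgroup.subset[OF N_sub] nb(1)] subsetD[OF \<beta>_sub nb(2)] by simp
        then have "q = g b"
          using x by (simp add: g_def r_coset_def)
        then show "q \<in> g ` \<beta> i"
          using nb(2) by blast
      qed
    qed
    have perpQ: "perp_Z ?Q"
      using perp_Z_surj[OF \<beta>(3) g_hom] g_onto by simp
    have cardQ: "|carrier ?Q| \<le>o |\<beta> i|"
      unfolding g_onto[symmetric] by (rule card_of_image)
    have "|carrier ?Q| \<le>o |carrier A|"
      by (rule ordLeq_transitive[OF cardQ card_of_mono1[OF \<beta>_sub]])
    then obtain K :: "'v monoid" where K: "K \<in> ab_groups" "?Q \<cong> K"
      using group_copy[OF Q sm] by blast
    have "|carrier K| =o |carrier ?Q|"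
      using iso_imp_eqpoll_carrier[OF K(2)] by (simp add: eqpoll_iff_card_of_ordIso ordIso_symmetric)
    then have "|carrier K| \<le>o \<kappa>"
      by (rule ordIso_ordLeq_trans[OF _ ordLeq_transitive[OF cardQ \<beta>(2)]])
    then have "less_presented \<mu> K"
      using less_presentedI[OF _ _ \<kappa>] K(1) unfolding ab_groups_def by blast
    then show "\<exists>K\<in>{M \<in> left_perp0 integer_group. less_presented \<mu> M}. ?Q \<cong> K"
      using K perp_Z_iso[OF perpQ K(2)] by (auto simp: left_perp0_integer_group)
  qed
  moreover have "carrier A = (\<Union>i\<in>Field r. N i)"
  proof
    show "carrier A \<subseteq> (\<Union>i\<in>Field r. N i)"
    proof
      fix x assume x: "x \<in> carrier A"
      then obtain j where "j \<in> Field r" "x \<in> underS r j"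
        using no_max[of x] Fr by (auto simp: underS_def)
      then show "x \<in> (\<Union>i\<in>Field r. N i)"
        using \<beta>_N \<beta>(4)[OF x] by blast
    qed
    show "(\<Union>i\<in>Field r. N i) \<subseteq> carrier A"
      using N_sub subgroup.subset by blast
  qed
  ultimately show ?thesis
    using A unfolding Filt_def by blast
qed

text \<open>The witness is the successor of \<open>\<kappa>\<close>: it is regular, and size at most
  \<open>\<kappa>\<close> means size below it.\<close>

lemma deconstructible_of_strongly_compact:
  fixes \<kappa> :: "'v::zfc rel"
  assumes \<kappa>: "omega1_strongly_compact \<kappa>"
  shows "deconstructible (left_perp0 integer_group :: 'v monoid set)"
proof -
  have card: "cardinal \<kappa>" and co: "Card_order \<kappa>" and leq: "natLeq \<le>o \<kappa>"
    using \<kappa> ordLess_imp_ordLeq unfolding omega1_strongly_compact_def cardinal_def by auto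
  obtain \<mu> :: "'v rel" where \<mu>: "cardinal \<mu>" "\<mu> =o cardSuc \<kappa>"
    using cardinal_successor[OF card] by blast
  have "cinfinite \<kappa>"
    using infinite_Field_of_natLeq[OF leq] by (simp add: cinfinite_def)
  then have suc: "Cinfinite (cardSuc \<kappa>)" "regularCard (cardSuc \<kappa>)"
    using co Cinfinite_cardSuc regularCard_cardSuc by auto
  have "Cinfinite \<mu>" "regularCard \<mu>"
    using Cinfinite_cong[OF ordIso_symmetric[OF \<mu>(2)] suc(1)]
      regularCard_ordIso[OF ordIso_symmetric[OF \<mu>(2)] suc] by auto
  moreover have "kappa_deconstructible \<mu> (left_perp0 integer_group :: 'v monoid set)"
    unfolding kappa_deconstructible_def
  proof (intro equalityI subsetI)
    fix A :: "'v monoid" assume "A \<in> left_perp0 integer_group"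
    then have "A \<in> ab_groups" "perp_Z A"
      by (auto simp: left_perp0_integer_group)
    then show "A \<in> Filt {M \<in> left_perp0 integer_group. less_presented \<mu> M}"
      using Filt_of_perp_cover[OF _ co leq \<mu>(2)] omega1_strongly_compact_perp_cover[OF \<kappa>] by blast
  next
    fix A :: "'v monoid" assume A: "A \<in> Filt {M \<in> left_perp0 integer_group. less_presented \<mu> M}"
    then have ab: "A \<in> ab_groups"
      unfolding Filt_def by blast
    obtain r N where N: "filtration {M \<in> left_perp0 integer_group. less_presented \<mu> M} A r N"
        "carrier A = (\<Union>i\<in>Field r. N i)"
      using A unfolding Filt_def by auto
    have "perp_Z A"
      by (rule perp_Z_filtration[OF _ N]) (use ab in \<open>auto simp: left_perp0_integer_group ab_groups_def\<close>)
    then show "A \<in> left_perp0 integer_group"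
      using ab by (simp add: left_perp0_integer_group)
  qed
  ultimately show ?thesis
    using \<mu>(1) unfolding deconstructible_def by blast
qed

subsection \<open>Slenderness of the integers\<close>

definition Z_linear :: "(('a \<Rightarrow> int) \<Rightarrow> int) \<Rightarrow> bool"
  where "Z_linear h \<longleftrightarrow> (\<forall>f g. h (\<lambda>x. f x + g x) = h f + h g)"

lemma Z_linear_add: "Z_linear h \<Longrightarrow> h (\<lambda>x. f x + g x) = h f + h g"
  unfolding Z_linear_def by blast

lemma Z_linear_zero: "Z_linear h \<Longrightarrow> h (\<lambda>x. 0) = 0"
  using Z_linear_add[of h "\<lambda>x. 0" "\<lambda>x. 0"] by simp

lemma Z_linear_uminus: "Z_linear h \<Longrightarrow> h (\<lambda>x. - f x) = - h f"
  using Z_linear_add[of h f "\<lambda>x. - f x"] Z_linear_zero[of h] by simp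

lemma Z_linear_scale:
  assumes "Z_linear h"
  shows "h (\<lambda>x. k * f x) = k * h f"
proof -
  have nat: "h (\<lambda>x. int n * f x) = int n * h f" for n
  proof (induction n)
    case 0
    then show ?case
      using Z_linear_zero[OF assms] by simp
  next
    case (Suc n)
    then show ?case
      using Z_linear_add[OF assms, of "\<lambda>x. int n * f x" f] by (simp add: algebra_simps)
  qed
  show ?thesis
  proof (cases "k \<ge> 0")
    case True
    then show ?thesis
      using nat[of "nat k"] by simp
  next
    case False
    then show ?thesis
      using nat[of "nat (- k)"] Z_linear_uminus[OF assms, of "\<lambda>x. int (nat (- k)) * f x"] by simp
  qed
qed

definition unit_seq :: "nat \<Rightarrow> nat \<Rightarrow> int"
  where "unit_seq n k = (if k = n then 1 else 0)"

text \<open>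
  Every integer sequence is a sum of two sequences whose \<open>k\<close>-th entries are divisible by
  \<open>2 ^ k\<close> and by \<open>3 ^ k\<close>, respectively.
\<close>

lemma Specker_zero:
  assumes g: "Z_linear g" and zero: "\<And>n. g (unit_seq n) = 0"
  shows "g a = 0"
proof -
  have trunc: "g (\<lambda>k. if k < n then b k else 0) = 0" for b n
  proof (induction n)
    case 0
    then show ?case
      using Z_linear_zero[OF g] by simp
  next
    case (Suc n)
    have "(\<lambda>k. if k < Suc n then b k else 0) = (\<lambda>k. (if k < n then b k else 0) + b n * unit_seq n k)"
      by (auto simp: unit_seq_def less_Suc_eq fun_eq_iff)
    then have "g (\<lambda>k. if k < Suc n then b k else 0)
        = g (\<lambda>k. if k < n then b k else 0) + g (\<lambda>k. b n * unit_seq n k)"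
      using Z_linear_add[OF g, of "\<lambda>k. if k < n then b k else 0" "\<lambda>k. b n * unit_seq n k"] by simp
    then show ?case
      using Suc Z_linear_scale[OF g, of "b n" "unit_seq n"] zero[of n] by simp
  qed
  \<comment> \<open>Dropping the first \<open>n\<close> entries does not change \<open>g b\<close>
    and leaves a multiple of \<open>p ^ n\<close>. So \<open>p ^ n\<close> divides
    \<open>g b\<close>, which is too small for \<open>n = \<bar>g b\<bar>\<close> unless it is
    zero.\<close>
  have divisible: "g b = 0" if p: "p \<ge> 2" and b: "\<And>k. p ^ k dvd b k" for b and p :: int
  proof (rule ccontr)
    assume nz: "g b \<noteq> 0"
    define n where "n = nat \<bar>g b\<bar>"
    define c where "c k = (if k < n then 0 else b k div p ^ n)" for k
    have "p ^ n dvd b k" if "n \<le> k" for k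
      using le_imp_power_dvd[OF that, of p] b[of k] by (rule dvd_trans)
    then have "b = (\<lambda>k. (if k < n then b k else 0) + p ^ n * c k)"
      by (auto simp: c_def)
    then have "g b = g (\<lambda>k. if k < n then b k else 0) + g (\<lambda>k. p ^ n * c k)"
      using Z_linear_add[OF g, of "\<lambda>k. if k < n then b k else 0" "\<lambda>k. p ^ n * c k"] by simp
    then have "g b = p ^ n * g c"
      using trunc Z_linear_scale[OF g, of "p ^ n" c] by simp
    then have "p ^ n dvd g b"
      by simp
    then have "p ^ n \<le> \<bar>g b\<bar>"
      using nz p dvd_imp_le_int[of "g b" "p ^ n"] by simp
    moreover have "int n < 2 ^ n"
      by simp
    moreover have "(2::int) ^ n \<le> p ^ n"
      using p by (intro power_mono) auto
    ultimately show False
      unfolding n_def by linarith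
  qed
  have "\<exists>u v. u * 2 ^ k + v * 3 ^ k = (1::int)" for k
  proof -
    have "coprime (2::int) 3"
      by (simp add: coprime_left_2_iff_odd)
    then have "coprime ((2::int) ^ k) (3 ^ k)"
      by simp
    then show ?thesis
      using bezout_int[of "2 ^ k" "3 ^ k"] by (auto simp: coprime_iff_gcd_eq_1)
  qed
  then obtain u v :: "nat \<Rightarrow> int" where uv: "\<And>k. u k * 2 ^ k + v k * 3 ^ k = 1"
    by metis
  have "a k = a k * u k * 2 ^ k + a k * v k * 3 ^ k" for k
    using arg_cong[OF uv[of k], of "\<lambda>x. a k * x"] by (simp add: algebra_simps)
  then have "a = (\<lambda>k. a k * u k * 2 ^ k + a k * v k * 3 ^ k)"
    by blast
  then have "g a = g (\<lambda>k. a k * u k * 2 ^ k) + g (\<lambda>k. a k * v k * 3 ^ k)"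
    using Z_linear_add[OF g, of "\<lambda>k. a k * u k * 2 ^ k" "\<lambda>k. a k * v k * 3 ^ k"] by simp
  then show ?thesis
    using divisible[of 2 "\<lambda>k. a k * u k * 2 ^ k"] divisible[of 3 "\<lambda>k. a k * v k * 3 ^ k"] by simp
qed

text \<open>
  Otherwise \<open>S \<mapsto> g (\<lambda>n. if n \<in> S then A n else 0)\<close> would embed the subsets of \<open>\<nat>\<close> into
  \<open>\<int>\<close>, where \<open>A (Suc n)\<close> is a multiple of \<open>A n\<close> not dividing \<open>A n * g (unit_seq n)\<close>.
\<close>

lemma Specker_finite_support:
  assumes g: "Z_linear g"
  shows "\<exists>n. g (unit_seq n) = 0"
proof (rule ccontr)
  assume "\<nexists>n. g (unit_seq n) = 0"
  then have nz: "g (unit_seq n) \<noteq> 0" for n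
    by blast
  \<comment> \<open>The factor \<open>\<bar>g (unit_seq n)\<bar> + 1\<close> exceeds the nonzero
    number \<open>g (unit_seq n)\<close> in absolute value and so cannot divide it.\<close>
  define A where "A = rec_nat 1 (\<lambda>n x. x * (\<bar>g (unit_seq n)\<bar> + 1))"
  have A_Suc: "A (Suc n) = A n * (\<bar>g (unit_seq n)\<bar> + 1)" and A_0: "A 0 = 1" for n
    unfolding A_def by auto
  have A_pos: "A n > 0" for n
    by (induction n) (auto simp: A_0 A_Suc)
  have A_dvd: "A m dvd A n" if "m \<le> n" for m n
    using that by (induction n rule: dec_induct) (auto simp: A_Suc)
  define \<phi> where "\<phi> S = g (\<lambda>n. if n \<in> S then A n else 0)" for S
  \<comment> \<open>At the first difference \<open>n\<close>, the two sequences differ by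
    \<open>A n\<close> times the unit vector plus a multiple of \<open>A (Suc n)\<close>. Equal
    values of \<open>g\<close> would violate the choice of \<open>A\<close>.\<close>
  have neq: "\<phi> S \<noteq> \<phi> T" if n: "n \<in> S" "n \<notin> T" "\<And>k. k < n \<Longrightarrow> k \<in> S \<longleftrightarrow> k \<in> T" for S T n
  proof
    assume eq: "\<phi> S = \<phi> T"
    define d where "d k = (if k \<in> S then A k else 0) - (if k \<in> T then A k else 0)" for k
    define t where "t k = (if k \<le> n then 0 else d k div A (Suc n))" for k
    have "(\<lambda>k. if k \<in> S then A k else 0) = (\<lambda>k. (if k \<in> T then A k else 0) + d k)"
      unfolding d_def by auto
    then have "\<phi> S = \<phi> T + g d"
      unfolding \<phi>_def using Z_linear_add[OF g, of "\<lambda>k. if k \<in> T then A k else 0" d] by simp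
    then have gd: "g d = 0"
      using eq by simp
    have "d k = A n * unit_seq n k + A (Suc n) * t k" for k
    proof -
      consider "k < n" | "k = n" | "n < k"
        by linarith
      then show ?thesis
      proof cases
        case 1
        then show ?thesis
          using n(3)[OF 1] by (simp add: d_def t_def unit_seq_def)
      next
        case 2
        then show ?thesis
          using n(1,2) by (simp add: d_def t_def unit_seq_def)
      next
        case 3
        then have "A (Suc n) dvd A k"
          by (intro A_dvd) simp
        then have "A (Suc n) dvd d k"
          by (auto simp: d_def)
        then show ?thesis
          using 3 by (simp add: t_def unit_seq_def)
      qed
    qed
    then have "d = (\<lambda>k. A n * unit_seq n k + A (Suc n) * t k)"
      by blast
    then have "g d = A n * g (unit_seq n) + A (Suc n) * g t"
      using Z_linear_add[OF g, of "\<lambda>k. A n * unit_seq n k" "\<lambda>k. A (Suc n) * t k"]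
        Z_linear_scale[OF g, of "A n" "unit_seq n"] Z_linear_scale[OF g, of "A (Suc n)" t] by simp
    then have "A n * (g (unit_seq n) + (\<bar>g (unit_seq n)\<bar> + 1) * g t) = 0"
      using gd by (simp add: A_Suc algebra_simps)
    then have "g (unit_seq n) + (\<bar>g (unit_seq n)\<bar> + 1) * g t = 0"
      using A_pos[of n] by simp
    then have "g (unit_seq n) = (\<bar>g (unit_seq n)\<bar> + 1) * (- g t)"
      by simp
    then have "(\<bar>g (unit_seq n)\<bar> + 1) dvd g (unit_seq n)"
      by (rule dvdI)
    then show False
      using dvd_imp_le_int[OF nz[of n]] by fastforce
  qed
  have "inj \<phi>"
  proof (rule injI, rule ccontr)
    fix S T assume eq: "\<phi> S = \<phi> T" and "S \<noteq> T"
    then have ex: "\<exists>n. (n \<in> S) \<noteq> (n \<in> T)"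
      by auto
    define n where "n = (LEAST n. (n \<in> S) \<noteq> (n \<in> T))"
    have n: "(n \<in> S) \<noteq> (n \<in> T)"
      unfolding n_def by (rule LeastI_ex[OF ex])
    have below: "k \<in> S \<longleftrightarrow> k \<in> T" if "k < n" for k
      using not_less_Least that unfolding n_def by blast
    show False
      using n neq[of n S T] neq[of n T S] below eq by auto
  qed
  then have "inj (to_nat \<circ> \<phi>)"
    by (intro inj_compose) auto
  then have "surj (inv_into UNIV (to_nat \<circ> \<phi>))"
    by (rule inj_imp_surj_inv)
  then show False
    using Cantors_theorem[of "UNIV :: nat set"] by auto
qed

subsection \<open>Ultrafilters from homomorphisms on products\<close>

text \<open>Functions supported on \<open>X\<close> stand for the subproduct of integers indexed by
  \<open>X\<close>. The sets with this property will form a countably complete ideal.\<close>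

definition vanishes_on :: "(('a \<Rightarrow> int) \<Rightarrow> int) \<Rightarrow> 'a set \<Rightarrow> bool"
  where "vanishes_on h X \<longleftrightarrow> (\<forall>f. (\<forall>x. x \<notin> X \<longrightarrow> f x = 0) \<longrightarrow> h f = 0)"

lemma vanishes_on_subset: "vanishes_on h X \<Longrightarrow> Z \<subseteq> X \<Longrightarrow> vanishes_on h Z"
  unfolding vanishes_on_def by (meson subsetD)

text \<open>Weighting \<open>f\<close> by a coefficient sequence along the first \<open>W n\<close>
  containing each point gives a homomorphism \<open>g\<close> on integer sequences. It kills unit
  vectors, hence everything, and the constant sequence 1 recovers \<open>h f\<close>.\<close>

lemma vanishes_on_UN:
  fixes W :: "nat \<Rightarrow> 'a set"
  assumes h: "Z_linear h" and W: "\<And>n. vanishes_on h (W n)"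
  shows "vanishes_on h (\<Union>n. W n)"
  unfolding vanishes_on_def
proof (intro allI impI)
  fix f :: "'a \<Rightarrow> int" assume f: "\<forall>x. x \<notin> (\<Union>n. W n) \<longrightarrow> f x = 0"
  define idx where "idx x = (LEAST n. x \<in> W n)" for x
  define g where "g a = h (\<lambda>x. a (idx x) * f x)" for a :: "nat \<Rightarrow> int"
  have "Z_linear g"
    unfolding Z_linear_def g_def using Z_linear_add[OF h] by (simp add: distrib_right)
  moreover have "g (unit_seq n) = 0" for n
  proof -
    have "unit_seq n (idx x) * f x = 0" if "x \<notin> W n" for x
    proof (cases "\<exists>m. x \<in> W m")
      case True
      then have "x \<in> W (idx x)"
        unfolding idx_def by (rule LeastI_ex)
      then show ?thesis
        using that by (auto simp: unit_seq_def)
    next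
      case False
      then show ?thesis
        using f by simp
    qed
    then show ?thesis
      using W[of n, unfolded vanishes_on_def, rule_format, of "\<lambda>x. unit_seq n (idx x) * f x"]
      unfolding g_def by simp
  qed
  ultimately have "g (\<lambda>n. 1) = 0"
    by (rule Specker_zero)
  then show "h f = 0"
    unfolding g_def by simp
qed

lemma vanishes_on_Un:
  assumes "Z_linear h" "vanishes_on h X" "vanishes_on h Z"
  shows "vanishes_on h (X \<union> Z)"
proof -
  have "vanishes_on h (\<Union>n::nat. if n = 0 then X else Z)"
    by (rule vanishes_on_UN) (use assms in auto)
  moreover have "X \<union> Z \<subseteq> (\<Union>n::nat. if n = 0 then X else Z)"
    by (auto split: if_splits intro: exI[of _ 0] exI[of _ 1])
  ultimately show ?thesis
    by (rule vanishes_on_subset)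
qed

text \<open>
  Otherwise repeated splitting yields infinitely many disjoint sets \<open>D n\<close> on which \<open>h\<close> does not
  vanish, against the slenderness of the integers.
\<close>

lemma vanishes_on_atom:
  fixes h :: "('a \<Rightarrow> int) \<Rightarrow> int"
  assumes h: "Z_linear h" "h f0 \<noteq> 0"
  shows "\<exists>X. \<not> vanishes_on h X \<and> (\<forall>Z. vanishes_on h (X \<inter> Z) \<or> vanishes_on h (X - Z))"
proof (rule ccontr)
  assume neg: "\<not> ?thesis"
  have "\<forall>X. \<exists>Z. \<not> vanishes_on h X \<longrightarrow> \<not> vanishes_on h (X \<inter> Z) \<and> \<not> vanishes_on h (X - Z)"
    using neg by auto
  then obtain Z where Z: "\<And>X. \<not> vanishes_on h X \<Longrightarrow>
      \<not> vanishes_on h (X \<inter> Z X) \<and> \<not> vanishes_on h (X - Z X)"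
    by metis
  \<comment> \<open>\<open>X n\<close> is what remains after \<open>n\<close> splittings, and
    \<open>D n\<close> below is the piece removed next.\<close>
  define X where "X n = ((\<lambda>X. X - Z X) ^^ n) UNIV" for n
  have X_Suc: "X (Suc n) = X n - Z (X n)" for n
    unfolding X_def by simp
  have X: "\<not> vanishes_on h (X n)" for n
  proof (induction n)
    case 0
    then show ?case
      using h(2) unfolding X_def vanishes_on_def by auto
  next
    case (Suc n)
    then show ?case
      using Z X_Suc by simp
  qed
  define D where "D n = X n \<inter> Z (X n)" for n
  have "\<exists>f. (\<forall>x. x \<notin> D n \<longrightarrow> f x = 0) \<and> h f \<noteq> 0" for n
    using Z[OF X[of n]] unfolding D_def vanishes_on_def by auto
  then obtain f where f: "\<And>n x. x \<notin> D n \<Longrightarrow> f n x = 0" "\<And>n. h (f n) \<noteq> 0"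
    by metis
  have X_anti: "X n \<subseteq> X m" if "m \<le> n" for m n
    using that by (induction n rule: dec_induct) (auto simp: X_Suc)
  have disj: "D m \<inter> D n = {}" if "m < n" for m n
    using X_anti[of "Suc m" n] that unfolding D_def X_Suc by auto
  have unique: "m = n" if "x \<in> D m" "x \<in> D n" for x m n
    using disj[of m n] disj[of n m] that by (metis IntI empty_iff linorder_neqE_nat)
  \<comment> \<open>The value is arbitrary outside all \<open>D n\<close>, where every
    \<open>f n\<close> is zero anyway.\<close>
  define idx where "idx x = (SOME n. x \<in> D n)" for x
  have idx: "idx x = n" if "x \<in> D n" for x n
    unfolding idx_def using that unique by (metis someI)
  define g where "g a = h (\<lambda>x. a (idx x) * f (idx x) x)" for a :: "nat \<Rightarrow> int"
  have "Z_linear g"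
    unfolding Z_linear_def g_def using Z_linear_add[OF h(1)] by (simp add: distrib_right)
  then obtain n where n: "g (unit_seq n) = 0"
    using Specker_finite_support by blast
  have "unit_seq n (idx x) * f (idx x) x = f n x" for x
    using idx[of x n] f(1)[of x n] by (cases "x \<in> D n") (auto simp: unit_seq_def)
  then show False
    using n f(2)[of n] unfolding g_def by simp
qed

text \<open>The sets on which \<open>h\<close> vanishes form a countably complete ideal, and its
  dual filter restricted to an atom \<open>X\<close> is an ultrafilter. It contains
  \<open>\<F>\<close> because a function supported off a set of \<open>\<F>\<close> is null.\<close>

lemma ultrafilter_of_Z_linear:
  fixes h :: "('a \<Rightarrow> int) \<Rightarrow> int"
  assumes \<F>: "filter_on Y \<F>" and h: "Z_linear h" "h f0 \<noteq> 0"
    and null: "\<And>f. {y\<in>Y. f y = 0} \<in> \<F> \<Longrightarrow> h f = 0"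
  shows "\<exists>\<U>. ultrafilter_on Y \<U> \<and> complete_family omega1 \<U> \<and> \<F> \<subseteq> \<U>"
proof -
  obtain X where X: "\<not> vanishes_on h X" "\<And>Z. vanishes_on h (X \<inter> Z) \<or> vanishes_on h (X - Z)"
    using vanishes_on_atom[OF h] by auto
  define \<U> where "\<U> = {Z. Z \<subseteq> Y \<and> vanishes_on h (X - Z)}"
  have up: "Z \<in> \<F>" if "V \<in> \<F>" "V \<subseteq> Z" "Z \<subseteq> Y" for V Z
    using \<F> that unfolding filter_on_def by auto
  have \<F>_sub: "Z \<subseteq> Y" if "Z \<in> \<F>" for Z
    using \<F> that unfolding filter_on_def by auto
  have \<F>\<U>: "\<F> \<subseteq> \<U>"
  proof
    fix Z assume Z: "Z \<in> \<F>"
    have "vanishes_on h (X - Z)"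
      unfolding vanishes_on_def
    proof (intro allI impI)
      fix f :: "'a \<Rightarrow> int" assume "\<forall>x. x \<notin> X - Z \<longrightarrow> f x = 0"
      then have "Z \<subseteq> {y\<in>Y. f y = 0}"
        using \<F>_sub[OF Z] by auto
      then show "h f = 0"
        by (intro null up[OF Z]) auto
    qed
    then show "Z \<in> \<U>"
      using \<F>_sub[OF Z] unfolding \<U>_def by simp
  qed
  have Y: "Y \<in> \<U>"
    using \<F>\<U> \<F> unfolding filter_on_def by auto
  have "filter_on Y \<U>"
    unfolding filter_on_def
  proof (intro conjI ballI allI impI)
    show "\<U> \<subseteq> Pow Y"
      unfolding \<U>_def by auto
    show "{} \<notin> \<U>"
      unfolding \<U>_def using X(1) by simp
    show "A \<inter> B \<in> \<U>" if "A \<in> \<U>" "B \<in> \<U>" for A B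
    proof -
      have "X - A \<inter> B = (X - A) \<union> (X - B)"
        by auto
      then show ?thesis
        using that vanishes_on_Un[OF h(1), of "X - A" "X - B"] unfolding \<U>_def by auto
    qed
    show "B \<in> \<U>" if "A \<in> \<U>" "A \<subseteq> B \<and> B \<subseteq> Y" for A B
      using that vanishes_on_subset[of h "X - A" "X - B"] unfolding \<U>_def by auto
  qed (rule Y)
  moreover have "A \<in> \<U> \<or> Y - A \<in> \<U>" if "A \<subseteq> Y" for A
  proof (cases "vanishes_on h (X \<inter> A)")
    case True
    \<comment> \<open>The atom \<open>X\<close> may have points outside \<open>Y\<close>;
      \<open>h\<close> vanishes on \<open>X - Y\<close> because \<open>Y\<close> is in
      \<open>\<U>\<close>.\<close>
    have "X - (Y - A) \<subseteq> (X \<inter> A) \<union> (X - Y)"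
      by auto
    moreover have "vanishes_on h ((X \<inter> A) \<union> (X - Y))"
      using vanishes_on_Un[OF h(1) True] Y unfolding \<U>_def by simp
    ultimately show ?thesis
      using vanishes_on_subset unfolding \<U>_def by auto
  next
    case False
    then show ?thesis
      using X(2)[of A] that unfolding \<U>_def by simp
  qed
  moreover have "complete_family omega1 \<U>"
    unfolding complete_family_def
  proof (intro allI impI, elim conjE)
    fix \<S> assume \<S>: "\<S> \<subseteq> \<U>" "\<S> \<noteq> {}" "|\<S>| <o omega1"
    then have "countable \<S>"
      using cardSuc_ordLeq_ordLess[OF natLeq_Card_order card_of_Card_order[of \<S>]]
      by (simp add: countable_card_le_natLeq)
    then obtain s :: "nat \<Rightarrow> 'a set" where s: "\<S> = range s"
      using \<S>(2) by (metis range_from_nat_into)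
    have "vanishes_on h (X - s n)" for n
      using \<S>(1) s unfolding \<U>_def by auto
    then have "vanishes_on h (\<Union>n. X - s n)"
      by (rule vanishes_on_UN[OF h(1)])
    moreover have "(\<Union>n. X - s n) = X - \<Inter>\<S>"
      using s by auto
    moreover have "\<Inter>\<S> \<subseteq> Y"
      using \<S>(1,2) unfolding \<U>_def by auto
    ultimately show "\<Inter>\<S> \<in> \<U>"
      unfolding \<U>_def by simp
  qed
  ultimately show ?thesis
    using \<F>\<U> unfolding ultrafilter_on_def by auto
qed

subsection \<open>From deconstructibility to strong compactness\<close>

text \<open>
  The reduced power of \<open>\<int>\<close> by a filter on \<open>Y\<close> is presented as a quotient of the group of all functions
  on the type; the values outside \<open>Y\<close> disappear in the quotient.
\<close>

definition integer_functions :: "('a \<Rightarrow> int) monoid"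
  where "integer_functions = \<lparr>carrier = UNIV, monoid.mult = (\<lambda>f g x. f x + g x), one = (\<lambda>x. 0)\<rparr>"

definition null_functions :: "'a set \<Rightarrow> 'a set set \<Rightarrow> ('a \<Rightarrow> int) set"
  where "null_functions Y \<F> = {f. {y\<in>Y. f y = 0} \<in> \<F>}"

lemma carrier_integer_functions [simp]: "carrier integer_functions = UNIV"
  and mult_integer_functions [simp]: "f \<otimes>\<^bsub>integer_functions\<^esub> g = (\<lambda>x. f x + g x)"
  and one_integer_functions [simp]: "\<one>\<^bsub>integer_functions\<^esub> = (\<lambda>x. 0)"
  by (auto simp: integer_functions_def)

lemma comm_group_integer_functions: "comm_group (integer_functions :: ('a \<Rightarrow> int) monoid)"
proof (rule comm_groupI)
  fix f :: "'a \<Rightarrow> int"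
  show "\<exists>g\<in>carrier integer_functions. g \<otimes>\<^bsub>integer_functions\<^esub> f = \<one>\<^bsub>integer_functions\<^esub>"
    by (rule bexI[of _ "\<lambda>x. - f x"]) auto
qed (auto simp: algebra_simps)

lemma inv_integer_functions [simp]: "inv\<^bsub>integer_functions\<^esub> f = (\<lambda>x. - f x)"
  by (rule group.inv_equality[OF comm_group.axioms(2)[OF comm_group_integer_functions]]) auto

lemma subgroup_null_functions:
  assumes "filter_on Y \<F>"
  shows "subgroup (null_functions Y \<F>) integer_functions"
proof (rule group.subgroupI[OF comm_group.axioms(2)[OF comm_group_integer_functions]])
  have "(\<lambda>x. 0) \<in> null_functions Y \<F>"
    using assms unfolding null_functions_def filter_on_def by simp
  then show "null_functions Y \<F> \<noteq> {}"
    by auto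
  show "inv\<^bsub>integer_functions\<^esub> f \<in> null_functions Y \<F>" if "f \<in> null_functions Y \<F>" for f
    using that unfolding null_functions_def by simp
  show "f \<otimes>\<^bsub>integer_functions\<^esub> g \<in> null_functions Y \<F>"
    if "f \<in> null_functions Y \<F>" "g \<in> null_functions Y \<F>" for f g
  proof -
    have "{y\<in>Y. f y = 0} \<inter> {y\<in>Y. g y = 0} \<in> \<F>"
      using assms that unfolding null_functions_def filter_on_def by simp
    moreover have "{y\<in>Y. f y = 0} \<inter> {y\<in>Y. g y = 0} \<subseteq> {y\<in>Y. f y + g y = 0}"
      by auto
    ultimately have "{y\<in>Y. f y + g y = 0} \<in> \<F>"
      using assms unfolding filter_on_def by (metis (no_types, lifting) mem_Collect_eq subsetI)
    then show ?thesis
      unfolding null_functions_def by simp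
  qed
qed auto

text \<open>A coset is determined by the values of any representative on \<open>Y\<close>. The graph
  of these values is coded as a subset of \<open>Y \<union> W\<close> through an injective pairing
  \<open>e\<close>.\<close>

lemma card_reduced_power:
  fixes Y :: "'v::zfc set"
  assumes Y: "small Y" and \<F>: "filter_on Y \<F>"
  shows "\<exists>P::'v set. small P \<and>
    |carrier (integer_functions Mod null_functions Y \<F>)| \<le>o |P|"
proof -
  obtain W :: "'v set" where W: "small W" "infinite W"
    using infinite_small_exists by blast
  let ?S = "Y \<union> W"
  let ?Q = "integer_functions Mod null_functions Y \<F>"
  have inf: "infinite ?S"
    using W(2) by simp
  have "|UNIV :: int set| \<le>o |?S|"
    using inf infinite_iff_card_of_countable[of "UNIV :: int set" ?S] by simp
  then have "|?S \<times> (UNIV :: int set)| \<le>o |?S|"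
    by (intro card_of_Times_ordLeq_infinite[OF inf]) auto
  then obtain e :: "'v \<times> int \<Rightarrow> 'v" where e: "inj_on e (?S \<times> UNIV)" "e ` (?S \<times> UNIV) \<subseteq> ?S"
    using card_of_ordLeq[of "?S \<times> (UNIV :: int set)" ?S] by auto
  obtain P :: "'v set" where P: "small P" "|Pow ?S| \<le>o |P|"
    using small_Pow_bound[OF small_Un[OF Y W(1)]] by auto
  define c where "c q = e ` {(y, (SOME f. f \<in> q) y) | y. y \<in> Y}" for q :: "('v \<Rightarrow> int) set"
  interpret G: comm_group "integer_functions :: ('v \<Rightarrow> int) monoid"
    by (rule comm_group_integer_functions)
  let ?N = "null_functions Y \<F>"
  have N: "subgroup ?N integer_functions"
    by (rule subgroup_null_functions[OF \<F>])
  have mem: "(SOME f. f \<in> q) \<in> q \<and> ?N #>\<^bsub>integer_functions\<^esub> (SOME f. f \<in> q) = q"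
    if q: "q \<in> carrier ?Q" for q
  proof -
    obtain f where f: "q = ?N #>\<^bsub>integer_functions\<^esub> f"
      using q by (auto simp: carrier_FactGroup)
    then have "f \<in> q"
      using G.rcos_self[OF _ N] by simp
    then have s: "(SOME f. f \<in> q) \<in> q"
      by (rule someI[of "\<lambda>f. f \<in> q"])
    then show ?thesis
      using G.repr_independence[OF _ _ N] f by (metis carrier_integer_functions UNIV_I)
  qed
  have "inj_on c (carrier ?Q)"
  proof (rule inj_onI)
    fix p q assume p: "p \<in> carrier ?Q" and q: "q \<in> carrier ?Q" and eq: "c p = c q"
    define f g where "f = (SOME f. f \<in> p)" and "g = (SOME f. f \<in> q)"
    have "{(y, f y) | y. y \<in> Y} = {(y, g y) | y. y \<in> Y}"
      using eq inj_on_image_eq_iff[OF e(1), of "{(y, f y) | y. y \<in> Y}" "{(y, g y) | y. y \<in> Y}"]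
      unfolding c_def f_def g_def by auto
    then have fg: "f y = g y" if "y \<in> Y" for y
      using that by auto
    have "{y\<in>Y. f y - g y = 0} = Y"
      using fg by auto
    then have "(\<lambda>x. f x - g x) \<in> ?N"
      using \<F> unfolding null_functions_def filter_on_def by simp
    then have "?N #>\<^bsub>integer_functions\<^esub> (\<lambda>x. f x - g x) = ?N"
      using G.coset_join2[OF _ N] by simp
    moreover have "?N #>\<^bsub>integer_functions\<^esub> (\<lambda>x. f x - g x) #>\<^bsub>integer_functions\<^esub> g
        = ?N #>\<^bsub>integer_functions\<^esub> f"
      using G.coset_mult_assoc[of ?N "\<lambda>x. f x - g x" g] by simp
    ultimately show "p = q"
      using mem[OF p] mem[OF q] unfolding f_def g_def by simp
  qed
  moreover have "c ` carrier ?Q \<subseteq> Pow ?S"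
    using e(2) unfolding c_def by auto
  ultimately have "|carrier ?Q| \<le>o |Pow ?S|"
    using card_of_ordLeq[of "carrier ?Q" "Pow ?S"] by auto
  then show ?thesis
    using P ordLeq_transitive by blast
qed

text \<open>
  A subgroup of size at most \<open>\<kappa>\<close> of the reduced power lifts to a group of functions on a single set of
  the filter, so that its elements are separated by evaluations.
\<close>

lemma reduced_power_not_perp_Z:
  fixes Y :: "'v::zfc set" and \<kappa> :: "'k rel"
  assumes Y: "small Y" and \<F>: "filter_on Y \<F>" "complete_family \<mu> \<F>"
    and \<kappa>: "Card_order \<kappa>" "natLeq \<le>o \<kappa>" "\<mu> =o cardSuc \<kappa>"
    and sub: "\<And>A::'v monoid. A \<in> left_perp0 integer_group \<Longrightarrow> carrier A \<noteq> {\<one>\<^bsub>A\<^esub>} \<Longrightarrow>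
      \<exists>B. subgroup B A \<and> B \<noteq> {\<one>\<^bsub>A\<^esub>} \<and> |B| \<le>o \<kappa> \<and> perp_Z (A\<lparr>carrier := B\<rparr>)"
  shows "\<not> perp_Z (integer_functions Mod null_functions Y \<F>)"
proof
  let ?F = "integer_functions :: ('v \<Rightarrow> int) monoid"
  let ?N = "null_functions Y \<F>"
  let ?Q = "?F Mod ?N"
  assume perp: "perp_Z ?Q"
  interpret G: comm_group ?F
    by (rule comm_group_integer_functions)
  have N: "subgroup ?N ?F"
    by (rule subgroup_null_functions[OF \<F>(1)])
  then have normal: "?N \<lhd> ?F"
    by (simp add: G.normal_iff_subgroup)
  interpret Q: comm_group ?Q
    by (rule G.abelian_FactGroup[OF N])
  obtain P :: "'v set" where P: "small P" "|carrier ?Q| \<le>o |P|"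
    using card_reduced_power[OF Y \<F>(1)] by auto
  \<comment> \<open>The assumption \<open>sub\<close> concerns groups over the universe only, so it
    is applied to a copy of the reduced power.\<close>
  obtain K :: "'v monoid" where K: "K \<in> ab_groups" "?Q \<cong> K"
    using group_copy[OF Q.comm_group_axioms P] by auto
  interpret K: comm_group K
    using K(1) unfolding ab_groups_def by simp
  have "K \<cong> ?Q"
    using Q.iso_sym K(2) by auto
  then obtain \<phi> where iso: "\<phi> \<in> iso K ?Q"
    unfolding is_iso_def by auto
  then have \<phi>: "\<phi> \<in> hom K ?Q" "inj_on \<phi> (carrier K)" "\<phi> ` carrier K = carrier ?Q"
    unfolding iso_def bij_betw_def by auto
  have \<phi>_one: "\<phi> \<one>\<^bsub>K\<^esub> = ?N"
    using hom_one[OF \<phi>(1) K.is_group Q.is_group] by simp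
  have Klp: "K \<in> left_perp0 integer_group"
    using K perp_Z_iso[OF perp K(2)] by (simp add: left_perp0_integer_group)
  have "carrier K \<noteq> {\<one>\<^bsub>K\<^esub>}"
  proof
    assume "carrier K = {\<one>\<^bsub>K\<^esub>}"
    then have "carrier ?Q = {?N}"
      using \<phi>(3) \<phi>_one by auto
    then have "?N #>\<^bsub>?F\<^esub> (\<lambda>x. 1) = ?N"
      by (auto simp: carrier_FactGroup)
    then have "(\<lambda>x. 1) \<in> ?N"
      using G.rcos_self[OF _ N, of "\<lambda>x. 1"] by simp
    then show False
      using \<F>(1) unfolding null_functions_def filter_on_def by simp
  qed
  then obtain B where B: "subgroup B K" "B \<noteq> {\<one>\<^bsub>K\<^esub>}" "|B| \<le>o \<kappa>" "perp_Z (K\<lparr>carrier := B\<rparr>)"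
    using sub[OF Klp] by auto
  have BK: "B \<subseteq> carrier K"
    by (rule subgroup.subset[OF B(1)])
  have "\<exists>f. \<phi> b = ?N #>\<^bsub>?F\<^esub> f" if "b \<in> B" for b
  proof -
    have "\<phi> b \<in> carrier ?Q"
      using that BK \<phi>(3) by auto
    then show ?thesis
      by (auto simp: carrier_FactGroup)
  qed
  then obtain \<rho> where \<rho>: "\<And>b. b \<in> B \<Longrightarrow> \<phi> b = ?N #>\<^bsub>?F\<^esub> \<rho> b"
    by metis
  \<comment> \<open>Representatives are additive only modulo null functions. \<open>E (b, c)\<close>
    is where additivity holds exactly for \<open>b\<close> and \<open>c\<close>, and at most
    \<open>\<kappa>\<close> such sets are intersected.\<close>
  define E where "E = (\<lambda>(b, c). {y\<in>Y. \<rho> (b \<otimes>\<^bsub>K\<^esub> c) y = \<rho> b y + \<rho> c y})"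
  have E: "E (b, c) \<in> \<F>" if bc: "b \<in> B" "c \<in> B" for b c
  proof -
    have bcB: "b \<otimes>\<^bsub>K\<^esub> c \<in> B"
      by (rule subgroup.m_closed[OF B(1) bc])
    have "?N #>\<^bsub>?F\<^esub> \<rho> (b \<otimes>\<^bsub>K\<^esub> c) = (?N #>\<^bsub>?F\<^esub> \<rho> b) <#>\<^bsub>?F\<^esub> (?N #>\<^bsub>?F\<^esub> \<rho> c)"
      using hom_mult[OF \<phi>(1), of b c] bc bcB BK \<rho> by auto
    also have "\<dots> = ?N #>\<^bsub>?F\<^esub> (\<lambda>x. \<rho> b x + \<rho> c x)"
      using normal.rcos_sum[OF normal, of "\<rho> b" "\<rho> c"] by simp
    finally have "\<rho> (b \<otimes>\<^bsub>K\<^esub> c) \<in> ?N #>\<^bsub>?F\<^esub> (\<lambda>x. \<rho> b x + \<rho> c x)"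
      using G.rcos_self[OF _ N, of "\<rho> (b \<otimes>\<^bsub>K\<^esub> c)"] by simp
    then obtain n where n: "n \<in> ?N" "\<rho> (b \<otimes>\<^bsub>K\<^esub> c) = (\<lambda>x. n x + (\<rho> b x + \<rho> c x))"
      unfolding r_coset_def by auto
    then have "E (b, c) = {y\<in>Y. n y = 0}"
      unfolding E_def by auto
    then show ?thesis
      using n(1) unfolding null_functions_def by simp
  qed
  have "|B \<times> B| \<le>o \<kappa>"
    by (rule card_of_Times_ordLeq_infinite_Field[OF infinite_Field_of_natLeq[OF \<kappa>(2)] B(3) B(3) \<kappa>(1)])
  then have "|E ` (B \<times> B)| \<le>o \<kappa>"
    by (rule ordLeq_transitive[OF card_of_image])
  then have "|E ` (B \<times> B)| <o \<mu>"
    using ordLess_cardSuc_iff[OF \<kappa>(1,3)] by auto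
  moreover have "E ` (B \<times> B) \<subseteq> \<F>"
    using E by auto
  moreover have "B \<noteq> {}"
    using subgroup.one_closed[OF B(1)] by auto
  ultimately have X: "\<Inter>(E ` (B \<times> B)) \<in> \<F>"
    using \<F>(2) unfolding complete_family_def by simp
  obtain b where b: "b \<in> B" "b \<noteq> \<one>\<^bsub>K\<^esub>"
    using B(2) subgroup.one_closed[OF B(1)] by auto
  \<comment> \<open>On the common intersection, evaluation of representatives at \<open>y\<close> is
    a homomorphism from the subgroup \<open>B\<close> to the integers, hence zero.\<close>
  have zero: "\<rho> b y = 0" if y: "y \<in> \<Inter>(E ` (B \<times> B))" for y
  proof -
    have "(\<lambda>c. \<rho> c y) \<in> hom (K\<lparr>carrier := B\<rparr>) integer_group"
    proof (rule hom_integer_groupI)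
      fix c d assume "c \<in> carrier (K\<lparr>carrier := B\<rparr>)" "d \<in> carrier (K\<lparr>carrier := B\<rparr>)"
      then have "y \<in> E (c, d)"
        using y by simp
      then show "\<rho> (c \<otimes>\<^bsub>K\<lparr>carrier := B\<rparr>\<^esub> d) y = \<rho> c y + \<rho> d y"
        unfolding E_def by simp
    qed
    then show ?thesis
      using B(4) b(1) unfolding perp_Z_def by auto
  qed
  have "\<Inter>(E ` (B \<times> B)) \<subseteq> {y\<in>Y. \<rho> b y = 0}"
    using zero b(1) unfolding E_def by auto
  then have "{y\<in>Y. \<rho> b y = 0} \<in> \<F>"
    using X \<F>(1) unfolding filter_on_def by (metis (no_types, lifting) mem_Collect_eq subsetI)
  then have "\<rho> b \<in> ?N"
    unfolding null_functions_def by simp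
  then have "\<phi> b = ?N"
    using \<rho>[OF b(1)] G.coset_join2[OF _ N] by simp
  then have "b = \<one>\<^bsub>K\<^esub>"
    using \<phi>(2) \<phi>_one b(1) BK unfolding inj_on_def by auto
  then show False
    using b(2) by simp
qed

text \<open>The witness is the successor of \<open>\<kappa>\<close>: lifting a subgroup of size at
  most \<open>\<kappa>\<close> intersects up to \<open>\<kappa>\<close> sets of the filter.\<close>

lemma strongly_compact_of_deconstructible:
  assumes "deconstructible (left_perp0 integer_group :: 'v::zfc monoid set)"
  shows "\<exists>\<mu> :: 'v rel. omega1_strongly_compact \<mu>"
proof -
  let ?D = "left_perp0 integer_group :: 'v monoid set"
  obtain \<kappa> :: "'v rel" where \<kappa>: "cardinal \<kappa>" "cinfinite \<kappa>" "kappa_deconstructible \<kappa> ?D"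
    using assms unfolding deconstructible_def by auto
  have co: "Card_order \<kappa>"
    using \<kappa>(1) unfolding cardinal_def by simp
  have leq: "natLeq \<le>o \<kappa>"
    using natLeq_ordLeq_cinfinite \<kappa>(2) co by auto
  obtain \<mu> :: "'v rel" where \<mu>: "cardinal \<mu>" "\<mu> =o cardSuc \<kappa>"
    using cardinal_successor[OF \<kappa>(1)] by auto
  have sub: "\<exists>B. subgroup B A \<and> B \<noteq> {\<one>\<^bsub>A\<^esub>} \<and> |B| \<le>o \<kappa> \<and> perp_Z (A\<lparr>carrier := B\<rparr>)"
    if A: "A \<in> ?D" "carrier A \<noteq> {\<one>\<^bsub>A\<^esub>}" for A
  proof -
    have "A \<in> Filt {M \<in> ?D. less_presented \<kappa> M}"
      using A(1) \<kappa>(3) unfolding kappa_deconstructible_def by simp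
    then obtain B K where B: "subgroup B A" "B \<noteq> {\<one>\<^bsub>A\<^esub>}"
      and K: "K \<in> {M \<in> ?D. less_presented \<kappa> M}" "A\<lparr>carrier := B\<rparr> \<cong> K"
      using A(2) by (rule Filt_nontrivial_subgroup)
    have "comm_group A"
      using A(1) by (simp add: left_perp0_integer_group ab_groups_def)
    then interpret B: comm_group "A\<lparr>carrier := B\<rparr>"
      using B(1) by (rule subgroup_comm_group)
    have "perp_Z (A\<lparr>carrier := B\<rparr>)"
      using perp_Z_iso[OF _ B.iso_sym[OF K(2)]] K(1) by (simp add: left_perp0_integer_group)
    moreover have "|B| =o |carrier K|"
      using iso_imp_eqpoll_carrier[OF K(2)] by (simp add: eqpoll_iff_card_of_ordIso)
    moreover have "|carrier K| \<le>o \<kappa>"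
      using less_presented_card[OF _ co leq] K(1) by simp
    ultimately show ?thesis
      using B ordIso_ordLeq_trans by blast
  qed
  have "omega1_strongly_compact \<mu>"
    unfolding omega1_strongly_compact_def
  proof (intro conjI allI impI)
    show "cardinal \<mu>" by fact
    have "natLeq <o cardSuc \<kappa>"
      by (rule ordLeq_ordLess_trans[OF leq cardSuc_greater[OF co]])
    then show "natLeq <o \<mu>"
      by (rule ordLess_ordIso_trans[OF _ ordIso_symmetric[OF \<mu>(2)]])
    fix Y :: "'v set" and \<F>
    assume "small Y \<and> filter_on Y \<F> \<and> complete_family \<mu> \<F>"
    then have Y: "small Y" and \<F>: "filter_on Y \<F>" "complete_family \<mu> \<F>"
      by auto
    let ?F = "integer_functions :: ('v \<Rightarrow> int) monoid"
    let ?N = "null_functions Y \<F>"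
    let ?Q = "?F Mod ?N"
    interpret G: comm_group ?F
      by (rule comm_group_integer_functions)
    have N: "subgroup ?N ?F"
      by (rule subgroup_null_functions[OF \<F>(1)])
    then have normal: "?N \<lhd> ?F"
      by (simp add: G.normal_iff_subgroup)
    interpret Q: comm_group ?Q
      by (rule G.abelian_FactGroup[OF N])
    have "\<not> perp_Z ?Q"
      by (rule reduced_power_not_perp_Z[OF Y \<F> co leq \<mu>(2) sub])
    then obtain f q where f: "f \<in> hom ?Q integer_group" and q: "q \<in> carrier ?Q" "f q \<noteq> 0"
      unfolding perp_Z_def by auto
    \<comment> \<open>Pulling \<open>f\<close> back along the quotient map gives a homomorphism on
      all functions that kills the null ones.\<close>
    define h where "h g = f (?N #>\<^bsub>?F\<^esub> g)" for g
    have "Z_linear h"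
      unfolding Z_linear_def
    proof (intro allI)
      fix g g'
      have "?N #>\<^bsub>?F\<^esub> (\<lambda>x. g x + g' x) = (?N #>\<^bsub>?F\<^esub> g) \<otimes>\<^bsub>?Q\<^esub> (?N #>\<^bsub>?F\<^esub> g')"
        using normal.rcos_sum[OF normal, of g g'] by simp
      then show "h (\<lambda>x. g x + g' x) = h g + h g'"
        using hom_integer_group_add[OF f, of "?N #>\<^bsub>?F\<^esub> g" "?N #>\<^bsub>?F\<^esub> g'"]
        unfolding h_def by (simp add: carrier_FactGroup)
    qed
    moreover obtain f0 where "h f0 \<noteq> 0"
      using q unfolding h_def by (auto simp: carrier_FactGroup)
    moreover have "h g = 0" if "{y\<in>Y. g y = 0} \<in> \<F>" for g
    proof -
      have "?N #>\<^bsub>?F\<^esub> g = ?N"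
        using that G.coset_join2[OF _ N, of g] by (simp add: null_functions_def)
      moreover have "f ?N = 0"
        using hom_one[OF f Q.is_group group_integer_group] by simp
      ultimately show ?thesis
        unfolding h_def by simp
    qed
    ultimately show "\<exists>\<U>. ultrafilter_on Y \<U> \<and> complete_family omega1 \<U> \<and> \<F> \<subseteq> \<U>"
      by (rule ultrafilter_of_Z_linear[OF \<F>(1)])
  qed
  then show ?thesis
    by blast
qed

theorem theorem1p2:
  shows "deconstructible (left_perp0 integer_group :: 'v::zfc monoid set) \<longleftrightarrow>
    (\<exists>\<kappa> :: 'v rel. omega1_strongly_compact \<kappa>)"
  using strongly_compact_of_deconstructible deconstructible_of_strongly_compact by blast

end
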